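(* Let $G$ be a (discrete) group. Then $C^*_\lambda(G)$ has a unique tracial state if and only if $$0 \in \overline{\mathrm{conv}}\{\lambda(sts^{-1}) \mid s \in G\}$$ for all $t \in G\setminus\{e\}$.
   Context: All groups are discrete; $e$ denotes the neutral element. $\lambda$ is the left-regular representation of $G$ on $\ell^2(G)$, and $C^*_\lambda(G)$ is the reduced group $C^*$-algebra (the norm-closed linear span of $\{\lambda(t)\mid t\in G\}$ in $B(\ell^2(G))$). $\overline{\mathrm{conv}}$ denotes the norm-closed convex hull in $C^*_\lambda(G)$. A tracial state is a state $\tau$ with $\tau(ab)=\tau(ba)$ for all $a,b$. *)

theory Defs
  imports "HOL-Analysis.Analysis"
begin

section \<open>The complex Hilbert space of square-summable functions\<close>

typedef 'a ell2 = "{f :: 'a \<Rightarrow> complex. (\<lambda>i. (cmod (f i))\<^sup>2) summable_on UNIV}"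
  morphisms ell2_nth Abs_ell2
  by (rule exI[of _ "\<lambda>_. 0"]) simp

setup_lifting type_definition_ell2

lemma ell2_add_closed:
  fixes f g :: "'a \<Rightarrow> complex"
  assumes "(\<lambda>i. (cmod (f i))\<^sup>2) summable_on UNIV" "(\<lambda>i. (cmod (g i))\<^sup>2) summable_on UNIV"
  shows "(\<lambda>i. (cmod (f i + g i))\<^sup>2) summable_on UNIV"
proof (rule summable_on_comparison_test)
  show "(\<lambda>i. 2 * (cmod (f i))\<^sup>2 + 2 * (cmod (g i))\<^sup>2) summable_on UNIV"
    by (intro summable_on_add summable_on_cmult_right assms)
  fix i :: 'a
  have "(cmod (f i + g i))\<^sup>2 \<le> (cmod (f i) + cmod (g i))\<^sup>2"
    by (intro power_mono norm_triangle_ineq) auto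
  also have "\<dots> \<le> 2 * (cmod (f i))\<^sup>2 + 2 * (cmod (g i))\<^sup>2"
    using sum_squares_bound[of "cmod (f i)" "cmod (g i)"] by (simp add: power2_sum)
  finally show "(cmod (f i + g i))\<^sup>2 \<le> 2 * (cmod (f i))\<^sup>2 + 2 * (cmod (g i))\<^sup>2" .
qed auto

lemma ell2_scale_closed:
  fixes f :: "'a \<Rightarrow> complex"
  assumes "(\<lambda>i. (cmod (f i))\<^sup>2) summable_on UNIV"
  shows "(\<lambda>i. (cmod (c * f i))\<^sup>2) summable_on UNIV"
  using summable_on_cmult_right[OF assms, of "(cmod c)\<^sup>2"]
  by (simp add: norm_mult power_mult_distrib)

lemma ell2_prod_summable:
  fixes f g :: "'a \<Rightarrow> complex"
  assumes "(\<lambda>i. (cmod (f i))\<^sup>2) summable_on UNIV" "(\<lambda>i. (cmod (g i))\<^sup>2) summable_on UNIV"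
  shows "(\<lambda>i. f i * cnj (g i)) summable_on UNIV"
proof -
  have "(\<lambda>i. cmod (f i * cnj (g i))) summable_on UNIV"
  proof (rule summable_on_comparison_test)
    show "(\<lambda>i. (cmod (f i))\<^sup>2 + (cmod (g i))\<^sup>2) summable_on UNIV"
      by (intro summable_on_add assms)
    fix i :: 'a
    have "cmod (f i * cnj (g i)) \<le> 2 * cmod (f i) * cmod (g i)"
      by (simp add: norm_mult)
    also have "\<dots> \<le> (cmod (f i))\<^sup>2 + (cmod (g i))\<^sup>2"
      by (rule sum_squares_bound)
    finally show "cmod (f i * cnj (g i)) \<le> (cmod (f i))\<^sup>2 + (cmod (g i))\<^sup>2" .
  qed auto
  then show ?thesis by (rule abs_summable_summable)
qed

lift_definition scaleC_ell2 :: "complex \<Rightarrow> 'a ell2 \<Rightarrow> 'a ell2" (infixr \<open>*\<^sub>C\<close> 75)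
  is "\<lambda>c f i. c * f i"
  by (simp add: ell2_scale_closed)

lift_definition cinner :: "'a ell2 \<Rightarrow> 'a ell2 \<Rightarrow> complex"
  is "\<lambda>f g. \<Sum>\<^sub>\<infinity>i. f i * cnj (g i)" .

instantiation ell2 :: (type) real_inner
begin

lift_definition zero_ell2 :: "'a ell2" is "\<lambda>_. 0" by simp
lift_definition plus_ell2 :: "'a ell2 \<Rightarrow> 'a ell2 \<Rightarrow> 'a ell2" is "\<lambda>f g i. f i + g i"
  by (simp add: ell2_add_closed)
lift_definition uminus_ell2 :: "'a ell2 \<Rightarrow> 'a ell2" is "\<lambda>f i. - f i" by simp
lift_definition minus_ell2 :: "'a ell2 \<Rightarrow> 'a ell2 \<Rightarrow> 'a ell2" is "\<lambda>f g i. f i - g i"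
  subgoal for f g using ell2_add_closed[of f "\<lambda>i. - g i"] by simp
  done
lift_definition scaleR_ell2 :: "real \<Rightarrow> 'a ell2 \<Rightarrow> 'a ell2" is "\<lambda>r f i. complex_of_real r * f i"
  by (simp add: ell2_scale_closed)
lift_definition norm_ell2 :: "'a ell2 \<Rightarrow> real" is "\<lambda>f. sqrt (\<Sum>\<^sub>\<infinity>i. (cmod (f i))\<^sup>2)" .
definition inner_ell2 :: "'a ell2 \<Rightarrow> 'a ell2 \<Rightarrow> real" where "inner_ell2 x y = Re (cinner x y)"
definition dist_ell2 :: "'a ell2 \<Rightarrow> 'a ell2 \<Rightarrow> real" where "dist_ell2 x y = norm (x - y)"
definition sgn_ell2 :: "'a ell2 \<Rightarrow> 'a ell2" where "sgn_ell2 x = inverse (norm x) *\<^sub>R x"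
definition uniformity_ell2 :: "('a ell2 \<times> 'a ell2) filter" where
  "uniformity_ell2 = (INF e\<in>{0<..}. principal {(x, y). dist x y < e})"
definition open_ell2 :: "'a ell2 set \<Rightarrow> bool" where
  "open_ell2 U \<longleftrightarrow> (\<forall>x\<in>U. \<forall>\<^sub>F (x', y) in uniformity. x' = x \<longrightarrow> y \<in> U)"

lemma cinner_self_ell2: "cinner x x = complex_of_real ((norm x)\<^sup>2)"
proof (transfer)
  fix f :: "'a \<Rightarrow> complex"
  assume f: "(\<lambda>i. (cmod (f i))\<^sup>2) summable_on UNIV"
  have "(\<Sum>\<^sub>\<infinity>i. f i * cnj (f i)) = (\<Sum>\<^sub>\<infinity>i. complex_of_real ((cmod (f i))\<^sup>2))"
    by (rule infsum_cong) (simp only: complex_norm_square)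
  also have "\<dots> = complex_of_real (\<Sum>\<^sub>\<infinity>i. (cmod (f i))\<^sup>2)"
    by (rule infsum_bounded_linear_strong[OF _ bounded_linear_of_real]) 
      (use f summable_on_bounded_linear[OF bounded_linear_of_real f] in simp)
  finally show "(\<Sum>\<^sub>\<infinity>i. f i * cnj (f i)) = complex_of_real ((sqrt (\<Sum>\<^sub>\<infinity>i. (cmod (f i))\<^sup>2))\<^sup>2)"
    by (simp add: infsum_nonneg)
qed

lemma cinner_add_left_ell2: "cinner (x + y) z = cinner x z + cinner y z"
  by transfer (simp add: distrib_right infsum_add ell2_prod_summable)

lemma cinner_scaleC_left: "cinner (c *\<^sub>C x) y = c * cinner x y"
  by transfer (simp add: mult.assoc infsum_cmult_right')

lemma cinner_commute: "cinner x y = cnj (cinner y x)"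
  by transfer (simp add: mult.commute flip: infsum_cnj)

lemma scaleR_ell2_scaleC: "r *\<^sub>R x = complex_of_real r *\<^sub>C (x :: 'a ell2)"
  by transfer simp

lemma norm_ell2_eq_0D: "norm (x :: 'a ell2) = 0 \<Longrightarrow> x = 0"
proof (transfer)
  fix f :: "'a \<Rightarrow> complex"
  assume f: "(\<lambda>i. (cmod (f i))\<^sup>2) summable_on UNIV" "sqrt (\<Sum>\<^sub>\<infinity>i. (cmod (f i))\<^sup>2) = 0"
  have "(cmod (f i))\<^sup>2 = 0" for i
    by (rule nonneg_infsum_le_0D[of _ UNIV]) (use f in auto)
  then show "f = (\<lambda>_. 0)" by auto
qed

instance
proof
  fix x y z :: "'a ell2" and a b :: real
  show "x + y + z = x + (y + z)" by transfer (simp add: add.assoc)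
  show "x + y = y + x" by transfer (simp add: add.commute)
  show "0 + x = x" by transfer simp
  show "- x + x = 0" by transfer simp
  show "x - y = x + - y" by transfer simp
  show "a *\<^sub>R (x + y) = a *\<^sub>R x + a *\<^sub>R y" by transfer (simp add: distrib_left)
  show "(a + b) *\<^sub>R x = a *\<^sub>R x + b *\<^sub>R x" by transfer (simp add: distrib_right)
  show "a *\<^sub>R b *\<^sub>R x = (a * b) *\<^sub>R x" by transfer (simp add: mult.assoc)
  show "1 *\<^sub>R x = x" by transfer simp
  show "dist x y = norm (x - y)" by (rule dist_ell2_def)
  show "sgn x = inverse (norm x) *\<^sub>R x" by (rule sgn_ell2_def)
  show "uniformity = (INF e\<in>{0<..}. principal {(x, y). dist (x :: 'a ell2) y < e})"
    by (rule uniformity_ell2_def)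
  show "open U = (\<forall>x\<in>U. \<forall>\<^sub>F (x', y) in uniformity. x' = x \<longrightarrow> y \<in> U)" for U :: "'a ell2 set"
    by (rule open_ell2_def)
  show "inner x y = inner y x"
    unfolding inner_ell2_def by (subst cinner_commute) simp
  show "inner (x + y) z = inner x z + inner y z"
    by (simp add: inner_ell2_def cinner_add_left_ell2)
  show "inner (a *\<^sub>R x) y = a * inner x y"
    by (simp add: inner_ell2_def scaleR_ell2_scaleC cinner_scaleC_left)
  show "0 \<le> inner x x" by (simp add: inner_ell2_def cinner_self_ell2)
  show "(inner x x = 0) = (x = 0)"
  proof
    show "inner x x = 0 \<Longrightarrow> x = 0"
      by (rule norm_ell2_eq_0D) (simp add: inner_ell2_def cinner_self_ell2)
    show "x = 0 \<Longrightarrow> inner x x = 0"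
      by (simp add: inner_ell2_def) (transfer, simp)
  qed
  have "norm x \<ge> 0" by transfer (simp add: infsum_nonneg)
  then show "norm x = sqrt (inner x x)"
    by (simp add: inner_ell2_def cinner_self_ell2)
qed

end

lemma norm_scaleC_ell2: "norm (c *\<^sub>C x) = cmod c * norm x"
  by transfer (simp add: norm_mult power_mult_distrib infsum_cmult_right' real_sqrt_mult)

lemma scaleC_ell2_add: "c *\<^sub>C (x + y) = c *\<^sub>C x + c *\<^sub>C y"
  by transfer (simp add: distrib_left)

lemma scaleC_ell2_scaleR: "c *\<^sub>C (r *\<^sub>R x) = r *\<^sub>R (c *\<^sub>C x)"
  by transfer (simp add: mult.left_commute)


section \<open>Bounded operators\<close>

text \<open>
  Elements of \<^typ>\<open>'a ell2 \<Rightarrow>\<^sub>L 'a ell2\<close> are only required to be real-linear. The operators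
  considered below are nevertheless complex-linear: they are norm limits of complex-linear operators, and
  the operator norm does not depend on the choice of scalar field.
\<close>

lemma bounded_linear_scaleC_ell2: "bounded_linear (\<lambda>x :: 'a ell2. c *\<^sub>C x)"
  by (rule bounded_linear_intro[where K = "cmod c"])
     (simp_all add: scaleC_ell2_add scaleC_ell2_scaleR norm_scaleC_ell2 mult.commute)

definition scaleC_op :: "complex \<Rightarrow> ('a ell2 \<Rightarrow>\<^sub>L 'a ell2) \<Rightarrow> ('a ell2 \<Rightarrow>\<^sub>L 'a ell2)" where
  "scaleC_op c a = Blinfun (\<lambda>x. c *\<^sub>C blinfun_apply a x)"

lemma scaleC_op_apply: "blinfun_apply (scaleC_op c a) x = c *\<^sub>C blinfun_apply a x"
  unfolding scaleC_op_def
  by (subst bounded_linear_Blinfun_apply)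
     (auto intro: bounded_linear_compose[OF bounded_linear_scaleC_ell2] blinfun.bounded_linear_right)

global_interpretation op_vs: vector_space "scaleC_op :: complex \<Rightarrow> ('a ell2 \<Rightarrow>\<^sub>L 'a ell2) \<Rightarrow> _"
proof
  fix c d :: complex and a b :: "'a ell2 \<Rightarrow>\<^sub>L 'a ell2"
  have 1: "(c + d) *\<^sub>C x = c *\<^sub>C x + d *\<^sub>C x" for x :: "'a ell2"
    by transfer (simp add: distrib_right)
  have 2: "c *\<^sub>C d *\<^sub>C x = (c * d) *\<^sub>C x" for x :: "'a ell2"
    by transfer (simp add: mult.assoc)
  have 3: "1 *\<^sub>C x = x" for x :: "'a ell2"
    by transfer simp
  show "scaleC_op c (a + b) = scaleC_op c a + scaleC_op c b"
    by (rule blinfun_eqI) (simp add: scaleC_op_apply blinfun.add_left scaleC_ell2_add)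
  show "scaleC_op (c + d) a = scaleC_op c a + scaleC_op d a"
    by (rule blinfun_eqI) (simp add: scaleC_op_apply blinfun.add_left 1)
  show "scaleC_op c (scaleC_op d a) = scaleC_op (c * d) a"
    by (rule blinfun_eqI) (simp add: scaleC_op_apply 2)
  show "scaleC_op 1 a = a"
    by (rule blinfun_eqI) (simp add: scaleC_op_apply 3)
qed

text \<open>
  The Hilbert space adjoint; it exists for every bounded complex-linear operator.
\<close>

definition adj :: "('a ell2 \<Rightarrow>\<^sub>L 'a ell2) \<Rightarrow> ('a ell2 \<Rightarrow>\<^sub>L 'a ell2)" where
  "adj a = (THE b. \<forall>x y. cinner (blinfun_apply a x) y = cinner x (blinfun_apply b y))"

lemma adj_eqI:
  assumes b: "\<And>x y. cinner (blinfun_apply a x) y = cinner x (blinfun_apply b y)"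
  shows "adj a = b"
  unfolding adj_def
proof (rule the_equality)
  show "\<forall>x y. cinner (blinfun_apply a x) y = cinner x (blinfun_apply b y)"
    using b by blast
  fix b' assume b': "\<forall>x y. cinner (blinfun_apply a x) y = cinner x (blinfun_apply b' y)"
  show "b' = b"
  proof (rule blinfun_eqI)
    fix y
    have "inner x (blinfun_apply b' y) = inner x (blinfun_apply b y)" for x
      using b b' by (simp add: inner_ell2_def)
    then have "inner (blinfun_apply b' y - blinfun_apply b y) (blinfun_apply b' y - blinfun_apply b y) = 0"
      unfolding inner_diff_right by simp
    then show "blinfun_apply b' y = blinfun_apply b y"
      unfolding inner_eq_zero_iff by simp
  qed
qed


section \<open>The reduced group C*-algebra\<close>

text \<open>
  The group is the type \<^typ>\<open>'g\<close> of class \<^class>\<open>group_add\<close>, the library's class of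
  not necessarily commutative groups, which is written additively:
  \<^term>\<open>0\<close> is the neutral element, and \<^term>\<open>s + t - s\<close> is the conjugate of \<open>t\<close> by \<open>s\<close>.
\<close>

lift_definition translate :: "'g::group_add \<Rightarrow> 'g ell2 \<Rightarrow> 'g ell2" is "\<lambda>t f s. f (- t + s)"
proof -
  fix t :: 'g and f :: "'g \<Rightarrow> complex"
  assume "(\<lambda>i. (cmod (f i))\<^sup>2) summable_on UNIV"
  then show "(\<lambda>s. (cmod (f (- t + s)))\<^sup>2) summable_on UNIV"
    by (subst summable_on_reindex_bij_betw[where g = "\<lambda>s. - t + s" and A = UNIV])
       (auto intro!: bij_betw_byWitness[where f' = "\<lambda>s. t + s"] simp flip: add.assoc)
qed

lemma norm_translate: "norm (translate t x) = norm x"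
proof transfer
  fix t :: "'g::group_add" and f :: "'g \<Rightarrow> complex"
  have "(\<Sum>\<^sub>\<infinity>s. (cmod (f (- t + s)))\<^sup>2) = (\<Sum>\<^sub>\<infinity>s. (cmod (f s))\<^sup>2)"
    by (rule infsum_reindex_bij_betw)
       (auto intro!: bij_betw_byWitness[where f' = "\<lambda>s. t + s"] simp flip: add.assoc)
  then show "sqrt (\<Sum>\<^sub>\<infinity>s. (cmod (f (- t + s)))\<^sup>2) = sqrt (\<Sum>\<^sub>\<infinity>s. (cmod (f s))\<^sup>2)" by simp
qed

definition lreg :: "'g::group_add \<Rightarrow> 'g ell2 \<Rightarrow>\<^sub>L 'g ell2" where
  "lreg t = Blinfun (translate t)"

lemma lreg_apply: "blinfun_apply (lreg t) = translate t"
  unfolding lreg_def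
proof (rule bounded_linear_Blinfun_apply, rule bounded_linear_intro[where K = 1])
  show "translate t (x + y) = translate t x + translate t y" for x y by transfer simp
  show "translate t (r *\<^sub>R x) = r *\<^sub>R translate t x" for r x by transfer simp
  show "norm (translate t x) \<le> norm x * 1" for x by (simp add: norm_translate)
qed

lemma lreg_zero: "lreg 0 = id_blinfun"
  by (rule blinfun_eqI) (simp add: lreg_apply, transfer, simp)

lemma lreg_add: "lreg (s + t) = lreg s o\<^sub>L lreg t"
  by (rule blinfun_eqI) (simp add: lreg_apply, transfer, simp add: minus_add add.assoc del: add_uminus_conv_diff)

lemma adj_lreg: "adj (lreg t) = lreg (- t)"
proof (rule adj_eqI)
  fix x y
  show "cinner (blinfun_apply (lreg t) x) y = cinner x (blinfun_apply (lreg (- t)) y)"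
    unfolding lreg_apply
  proof transfer
    fix t :: "'g::group_add" and f g :: "'g \<Rightarrow> complex"
    have "(\<Sum>\<^sub>\<infinity>s. f (- t + s) * cnj (g s)) = (\<Sum>\<^sub>\<infinity>s. f (- t + (t + s)) * cnj (g (t + s)))"
      by (rule infsum_reindex_bij_betw[symmetric])
         (auto intro!: bij_betw_byWitness[where f' = "\<lambda>s. - t + s"] simp flip: add.assoc)
    then show "(\<Sum>\<^sub>\<infinity>s. f (- t + s) * cnj (g s)) = (\<Sum>\<^sub>\<infinity>s. f s * cnj (g (- (- t) + s)))"
      by (simp flip: add.assoc)
  qed
qed

definition reduced_Cstar :: "('g::group_add ell2 \<Rightarrow>\<^sub>L 'g ell2) set" where
  "reduced_Cstar = closure (op_vs.span (range lreg))"


section \<open>Tracial states\<close>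

text \<open>
  A functional on \<open>A\<close> is represented by a function on all operators which is \<^const>\<open>extensional\<close>,
  so that two functionals are equal iff they agree on \<open>A\<close>. The set \<open>A\<close> is meant to be a
  C*-subalgebra containing the identity operator, for which positive functionals of norm \<open>1\<close>
  are the same as unital positive functionals.
\<close>

definition is_state :: "('a ell2 \<Rightarrow>\<^sub>L 'a ell2) set \<Rightarrow> (('a ell2 \<Rightarrow>\<^sub>L 'a ell2) \<Rightarrow> complex) \<Rightarrow> bool" where
  "is_state A \<phi> \<longleftrightarrow> \<phi> \<in> extensional A \<and>
    (\<forall>a\<in>A. \<forall>b\<in>A. \<phi> (a + b) = \<phi> a + \<phi> b) \<and>
    (\<forall>c. \<forall>a\<in>A. \<phi> (scaleC_op c a) = c * \<phi> a) \<and>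
    (\<forall>a\<in>A. \<phi> (adj a o\<^sub>L a) \<in> \<real>\<^sub>\<ge>\<^sub>0) \<and>
    \<phi> id_blinfun = 1"

definition is_tracial_state ::
  "('a ell2 \<Rightarrow>\<^sub>L 'a ell2) set \<Rightarrow> (('a ell2 \<Rightarrow>\<^sub>L 'a ell2) \<Rightarrow> complex) \<Rightarrow> bool" where
  "is_tracial_state A \<tau> \<longleftrightarrow> is_state A \<tau> \<and> (\<forall>a\<in>A. \<forall>b\<in>A. \<tau> (a o\<^sub>L b) = \<tau> (b o\<^sub>L a))"

end

theory Submission
  imports Defs
begin

text \<open>
  A tracial state is constant on the closed convex hull of a conjugacy class, so if each of these
  hulls contains \<open>0\<close>, the canonical trace is the only one. Conversely, let \<open>p\<close> be a minimal translation
  invariant sublinear functional on the bounded real functions on the group. If \<open>p (h + t h) < 2 p h\<close>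
  for some \<open>h\<close>, where \<open>t h\<close> is a translate, then minimality provides a set \<open>E\<close> disjoint from its
  translate by \<open>t\<close> and finitely many translates of \<open>E\<close> such that each point lies in most of them;
  the corresponding average of conjugates of \<open>lreg t\<close> has small norm by the Cauchy--Schwarz inequality.
  Otherwise \<open>p (t f - f) \<le> 0\<close> for all \<open>f\<close>. The \<open>t\<close> with this property form a normal
  subgroup \<open>N\<close>, which is amenable: the Hilbert space of functions supported in \<open>N\<close> has almost
  \<open>N\<close>-invariant unit vectors. A limit of their vector states is a tracial state that is the indicator
  function of \<open>N\<close> on the group, so uniqueness of the trace forces \<open>N\<close> to be trivial.
\<close>

section \<open>Minimal invariant sublinear functionals\<close>

text \<open>By Hahn-Banach, \<open>p\<close> is the support function of a minimal
  translation-invariant compact convex set of means, namely the linear functionals below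
  \<open>p\<close>. It replaces a topological boundary: \<open>N\<close> consists of the elements
  acting trivially on this set, and minimality is spent only once, on averages of a Poisson
  transform. The factor 2 encodes the dichotomy. Equality \<open>p (h + t h) = 2 p h\<close> says
  that one mean is maximal on \<open>h\<close> and on its translate at the same time; its failure
  leaves a gap that separates a level set from its translate. The indicator of \<open>N\<close>
  extends to a bounded functional on the reduced algebra only if \<open>N\<close> is amenable, so
  invariance of means has to be converted into almost invariant vectors. This is a Kesten-type
  spectral argument, run by contradiction. States are given only as positive unital functionals, on
  operators whose type guarantees just real linearity. Continuity of states is therefore derived
  from square roots, and complex linearity of operators from adjoints.\<close>

definition sublinear :: "('v::real_vector \<Rightarrow> real) \<Rightarrow> bool" where
  "sublinear p \<longleftrightarrow> (\<forall>v w. p (v + w) \<le> p v + p w) \<and> (\<forall>c\<ge>0. \<forall>v. p (c *\<^sub>R v) = c * p v)"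

text \<open>Homogeneity needs checking in one direction only: the inequality for
  \<open>inverse c\<close> gives the other.\<close>

lemma sublinearI:
  assumes "\<And>v w. p (v + w) \<le> p v + p w" "p 0 = 0" "\<And>c v. c > 0 \<Longrightarrow> p (c *\<^sub>R v) \<le> c * p v"
  shows "sublinear p"
proof -
  have "p (c *\<^sub>R v) = c * p v" if "c \<ge> 0" for c v
  proof (cases "c = 0")
    case False
    with that have c: "c > 0" by simp
    have "p (inverse c *\<^sub>R c *\<^sub>R v) \<le> inverse c * p (c *\<^sub>R v)"
      using c by (intro assms(3)) simp
    then have "c * p v \<le> p (c *\<^sub>R v)"
      using c by (simp add: field_simps)
    with assms(3)[OF c, of v] show ?thesis by simp
  qed (simp add: assms(2))
  with assms(1) show ?thesis
    by (simp add: sublinear_def)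
qed

context
  fixes p :: "'v::real_vector \<Rightarrow> real"
  assumes p: "sublinear p"
begin

lemma sublinear_add: "p (v + w) \<le> p v + p w"
  and sublinear_scaleR: "c \<ge> 0 \<Longrightarrow> p (c *\<^sub>R v) = c * p v"
  using p by (auto simp: sublinear_def)

lemma sublinear_zero: "p 0 = 0"
  using sublinear_scaleR[of 0 0] by simp

lemma sublinear_uminus: "- p (- v) \<le> p v"
  using sublinear_add[of v "- v"] by (simp add: sublinear_zero)

lemma sublinear_sum: "p (\<Sum>i\<in>I. f i) \<le> (\<Sum>i\<in>I. p (f i))"
proof (induction I rule: infinite_finite_induct)
  case (insert x F)
  then show ?case
    using sublinear_add[of "f x" "\<Sum>i\<in>F. f i"] by simp
qed (simp_all add: sublinear_zero)

end

text \<open>Zorn's lemma for the reversed pointwise order. The infimum of a chain is finite because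
  every member is at least \<open>- p0 (- v)\<close> at \<open>v\<close>, and subadditive because
  two members of a chain have a common minorant in it. With \<open>T\<close> empty this also serves
  Hahn-Banach.\<close>

lemma minimal_sublinear:
  fixes p0 :: "'v::real_vector \<Rightarrow> real" and T :: "('v \<Rightarrow> 'v) set"
  assumes p0: "sublinear p0" and inv: "\<And>f v. f \<in> T \<Longrightarrow> p0 (f v) = p0 v"
  obtains p where "sublinear p" "\<And>v. p v \<le> p0 v" "\<And>f v. f \<in> T \<Longrightarrow> p (f v) = p v"
    "\<And>q v. \<lbrakk>sublinear q; \<And>v. q v \<le> p v; \<And>f v. f \<in> T \<Longrightarrow> q (f v) = q v\<rbrakk> \<Longrightarrow> q v = p v"
proof -
  define A where "A = {p. sublinear p \<and> p \<le> p0 \<and> (\<forall>f\<in>T. \<forall>v. p (f v) = p v)}"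
  let ?R = "relation_of (\<lambda>p q. q \<le> p) A"
  have "\<exists>m\<in>A. \<forall>a\<in>A. a \<le> m \<longrightarrow> a = m"
  proof (rule predicate_Zorn)
    show "partial_order_on A ?R"
      by (rule partial_order_on_relation_ofI) auto
    fix C assume C: "C \<in> Chains ?R"
    then have CA: "C \<subseteq> A" and total: "\<And>p q. p \<in> C \<Longrightarrow> q \<in> C \<Longrightarrow> p \<le> q \<or> q \<le> p"
      by (auto simp: Chains_def relation_of_def)
    show "\<exists>u\<in>A. \<forall>a\<in>C. u \<le> a"
    proof (cases "C = {}")
      case True
      then show ?thesis
        using p0 inv by (intro bexI[of _ p0]) (auto simp: A_def)
    next
      case False
      define u where "u v = (INF p\<in>C. p v)" for v
      have bdd: "bdd_below ((\<lambda>p. p v) ` C)" for v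
      proof (rule bdd_belowI2[of _ "- p0 (- v)"])
        fix p assume "p \<in> C"
        then have "sublinear p" "p (- v) \<le> p0 (- v)"
          using CA by (auto simp: A_def le_fun_def)
        then show "- p0 (- v) \<le> p v"
          using sublinear_uminus[of p v] by simp
      qed
      have u_le: "u v \<le> p v" if "p \<in> C" for p v
        unfolding u_def by (rule cINF_lower[OF bdd that])
      have u_ge: "c \<le> u v" if "\<And>p. p \<in> C \<Longrightarrow> c \<le> p v" for c v
        unfolding u_def by (rule cINF_greatest[OF False that])
      have "sublinear u"
      proof (rule sublinearI)
        fix v w :: 'v and c :: real
        have "u (v + w) - p v \<le> q w" if pq: "p \<in> C" "q \<in> C" for p q
        proof -
          obtain r where r: "r \<in> C" "r \<le> p" "r \<le> q"
            using total[OF pq] pq by auto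
          then have "r (v + w) \<le> r v + r w" "r v \<le> p v" "r w \<le> q w"
            using CA by (auto simp: A_def le_fun_def intro: sublinear_add)
          with u_le[OF r(1), of "v + w"] show ?thesis by simp
        qed
        then have "u (v + w) - p v \<le> u w" if "p \<in> C" for p
          using that by (intro u_ge) auto
        then have "u (v + w) - u w \<le> u v"
          by (intro u_ge) (simp add: algebra_simps)
        then show "u (v + w) \<le> u v + u w" by simp
        have "u 0 = (INF p\<in>C. 0)"
          using CA unfolding u_def by (intro INF_cong) (auto simp: A_def sublinear_zero)
        then show "u 0 = 0"
          using False by simp
        assume c: "c > 0"
        have "u (c *\<^sub>R v) / c \<le> p v" if "p \<in> C" for p
        proof -
          have "p (c *\<^sub>R v) = c * p v"
            using that CA c by (auto simp: A_def intro!: sublinear_scaleR)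
          then show ?thesis
            using u_le[OF that, of "c *\<^sub>R v"] c by (simp add: field_simps)
        qed
        then have "u (c *\<^sub>R v) / c \<le> u v"
          by (rule u_ge)
        then show "u (c *\<^sub>R v) \<le> c * u v"
          using c by (simp add: field_simps)
      qed
      moreover have "u \<le> p0"
      proof (rule le_funI)
        fix v
        obtain p where "p \<in> C" using False by blast
        then have "u v \<le> p v" "p v \<le> p0 v"
          using CA u_le by (auto simp: A_def le_fun_def)
        then show "u v \<le> p0 v" by (rule order_trans)
      qed
      moreover have "u (f v) = u v" if "f \<in> T" for f v
        using that CA unfolding u_def A_def by (intro INF_cong) auto
      ultimately show ?thesis
        using u_le by (intro bexI[of _ u]) (auto simp: A_def le_fun_def)
    qed
  qed
  then obtain p where p: "p \<in> A" "\<And>q. q \<in> A \<Longrightarrow> q \<le> p \<Longrightarrow> q = p" by blast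
  show thesis
  proof
    fix q v assume q: "sublinear q" "\<And>v. q v \<le> p v" "\<And>f v. f \<in> T \<Longrightarrow> q (f v) = q v"
    have "q \<le> p"
      using q(2) by (rule le_funI)
    moreover from this have "q \<in> A"
      using q(1,3) p(1) by (simp add: A_def) (rule order_trans[of q p p0], simp_all)
    ultimately have "q = p"
      by (intro p(2))
    then show "q v = p v" by simp
  qed (use p(1) in \<open>auto simp: A_def le_fun_def\<close>)
qed

text \<open>The Hahn--Banach theorem: a minimal sublinear functional is linear.\<close>

lemma linear_below_sublinear:
  fixes p :: "'v::real_vector \<Rightarrow> real"
  assumes "sublinear p"
  obtains m where "linear m" "\<And>v. m v \<le> p v"
proof -
  obtain m where m: "sublinear m" "\<And>v. m v \<le> p v"
    and min: "\<And>q v. sublinear q \<Longrightarrow> (\<And>v. q v \<le> m v) \<Longrightarrow> q v = m v"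
  proof (rule minimal_sublinear[OF assms, of "{}"])
    fix m :: "'v \<Rightarrow> real"
    assume m: "sublinear m" "\<And>v. m v \<le> p v"
      "\<And>q v. \<lbrakk>sublinear q; \<And>v. q v \<le> m v; \<And>f v. f \<in> {} \<Longrightarrow> q (f v) = q v\<rbrakk> \<Longrightarrow> q v = m v"
    show thesis
    proof (rule that[OF m(1,2)])
      fix q v assume q: "sublinear q" "\<And>v. q v \<le> m v"
      show "q v = m v"
        by (rule m(3)[OF q]) blast
    qed
  qed blast
  note m_add = sublinear_add[OF m(1)] and m_scale = sublinear_scaleR[OF m(1)]
    and m_0 = sublinear_zero[OF m(1)]
  have neg: "m (- v) = - m v" for v
  proof -
    \<comment> \<open>The one-vector improvement of \<open>m\<close>: \<open>c = 0\<close> gives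
      \<open>q \<le> m\<close>, and \<open>c = 1\<close> at \<open>- v\<close> gives
      \<open>q (- v) \<le> - m v\<close>, which minimality transfers to \<open>m\<close>.\<close>
    define q where "q w = (INF c\<in>{0..}. m (w + c *\<^sub>R v) - c * m v)" for w
    have bdd: "bdd_below ((\<lambda>c. m (w + c *\<^sub>R v) - c * m v) ` {0..})" for w
    proof (rule bdd_belowI2[of _ "- m (- w)"])
      fix c :: real assume "c \<in> {0..}"
      then show "- m (- w) \<le> m (w + c *\<^sub>R v) - c * m v"
        using m_add[of "w + c *\<^sub>R v" "- w"] m_scale[of c v] by simp
    qed
    have q_le: "q w \<le> m (w + c *\<^sub>R v) - c * m v" if "c \<ge> 0" for w c
      unfolding q_def using that by (intro cINF_lower[OF bdd]) auto
    have q_ge: "d \<le> q w" if "\<And>c. c \<ge> 0 \<Longrightarrow> d \<le> m (w + c *\<^sub>R v) - c * m v" for w d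
      unfolding q_def using that by (intro cINF_greatest) auto
    have "sublinear q"
    proof (rule sublinearI)
      fix w w' :: 'v and d :: real
      have *: "q (w + w') \<le> (m (w + c *\<^sub>R v) - c * m v) + (m (w' + c' *\<^sub>R v) - c' * m v)"
        if "c \<ge> 0" "c' \<ge> 0" for c c'
      proof -
        have "q (w + w') \<le> m ((w + w') + (c + c') *\<^sub>R v) - (c + c') * m v"
          using that by (intro q_le) simp
        also have "(w + w') + (c + c') *\<^sub>R v = (w + c *\<^sub>R v) + (w' + c' *\<^sub>R v)"
          by (simp add: algebra_simps)
        finally show ?thesis
          using m_add[of "w + c *\<^sub>R v" "w' + c' *\<^sub>R v"] by (simp add: algebra_simps)
      qed
      have "q (w + w') - (m (w + c *\<^sub>R v) - c * m v) \<le> q w'" if "c \<ge> 0" for c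
        using *[OF that] by (intro q_ge) (simp add: algebra_simps)
      then have "q (w + w') - q w' \<le> q w"
        by (intro q_ge) (simp add: algebra_simps)
      then show "q (w + w') \<le> q w + q w'" by simp
      have "q 0 \<ge> 0"
        by (rule q_ge) (simp add: m_scale)
      then show "q 0 = 0"
        using q_le[of 0 0] m_0 by simp
      assume d: "d > 0"
      have "q (d *\<^sub>R w) / d \<le> q w"
      proof (rule q_ge)
        fix c :: real assume c: "c \<ge> 0"
        have "q (d *\<^sub>R w) \<le> m (d *\<^sub>R w + (d * c) *\<^sub>R v) - (d * c) * m v"
          using c d by (intro q_le) simp
        also have "d *\<^sub>R w + (d * c) *\<^sub>R v = d *\<^sub>R (w + c *\<^sub>R v)"
          by (simp add: algebra_simps)
        also have "m \<dots> = d * m (w + c *\<^sub>R v)"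
          using d by (intro m_scale) simp
        finally show "q (d *\<^sub>R w) / d \<le> m (w + c *\<^sub>R v) - c * m v"
          using d by (simp add: field_simps)
      qed
      then show "q (d *\<^sub>R w) \<le> d * q w"
        using d by (simp add: field_simps)
    qed
    moreover have "q w \<le> m w" for w
      using q_le[of 0 w] by simp
    ultimately have "q (- v) = m (- v)"
      by (rule min)
    then show ?thesis
      using q_le[of 1 "- v"] m_0 m_add[of v "- v"] by simp
  qed
  have "linear m"
  proof (rule linearI)
    fix v w and c :: real
    have "m (- v + - w) \<le> m (- v) + m (- w)" by (rule m_add)
    then show "m (v + w) = m v + m w"
      using m_add[of v w] neg[of "v + w"] by (simp add: neg)
    show "m (c *\<^sub>R v) = c *\<^sub>R m v"
    proof (cases "c \<ge> 0")
      case False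
      then show ?thesis
        using m_scale[of "- c" v] neg[of "c *\<^sub>R v"] by simp
    qed (simp add: m_scale)
  qed
  then show thesis
    using m(2) that by blast
qed

section \<open>Bounded functions on a group\<close>

typedef 'a bfun = "{f :: 'a \<Rightarrow> real. bounded (range f)}"
  morphisms bfun_apply Abs_bfun
  by (rule exI[of _ "\<lambda>_. 0"]) simp

setup_lifting type_definition_bfun

instantiation bfun :: (type) real_vector
begin

lift_definition zero_bfun :: "'a bfun" is "\<lambda>_. 0" by simp
lift_definition plus_bfun :: "'a bfun \<Rightarrow> 'a bfun \<Rightarrow> 'a bfun" is "\<lambda>f g x. f x + g x"
  by (rule bounded_plus_comp)
lift_definition uminus_bfun :: "'a bfun \<Rightarrow> 'a bfun" is "\<lambda>f x. - f x"
  by simp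
lift_definition minus_bfun :: "'a bfun \<Rightarrow> 'a bfun \<Rightarrow> 'a bfun" is "\<lambda>f g x. f x - g x"
  by (rule bounded_minus_comp)
lift_definition scaleR_bfun :: "real \<Rightarrow> 'a bfun \<Rightarrow> 'a bfun" is "\<lambda>r f x. r * f x"
  subgoal for r f using bounded_scaleR_comp[of f UNIV r] by simp
  done

instance
  by standard (transfer; simp add: algebra_simps)+

end

lemmas bfun_simps [simp] =
  zero_bfun.rep_eq plus_bfun.rep_eq uminus_bfun.rep_eq minus_bfun.rep_eq scaleR_bfun.rep_eq

lift_definition bconst :: "real \<Rightarrow> 'a bfun" is "\<lambda>c _. c"
  by simp

lemmas [simp] = bconst.rep_eq

text \<open>No inverse is taken, so this is a right action: composing translations reverses the
  order of the group elements.\<close>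

lift_definition lshift :: "'g::group_add \<Rightarrow> 'g bfun \<Rightarrow> 'g bfun" is "\<lambda>g f x. f (g + x)"
  by (rule bounded_subset) auto

lemmas [simp] = lshift.rep_eq

lemma bfun_eqI: "(\<And>x. bfun_apply f x = bfun_apply g x) \<Longrightarrow> f = g"
  by transfer auto

lemma linear_lshift: "linear (lshift g)"
  by (rule linearI; transfer; simp)

lemma lshift_zero [simp]: "lshift 0 f = f"
  by (rule bfun_eqI) simp

lemma lshift_lshift: "lshift g (lshift h f) = lshift (h + g) f"
  by (rule bfun_eqI) (simp add: add.assoc)

definition bsup :: "'a bfun \<Rightarrow> real" where
  "bsup f = (SUP x. bfun_apply f x)"

lemma bfun_le_bsup: "bfun_apply f x \<le> bsup f"
proof -
  have "bounded (range (bfun_apply f))"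
    by transfer
  then show ?thesis
    unfolding bsup_def by (intro cSUP_upper bounded_imp_bdd_above) auto
qed

lemma bsup_least: "(\<And>x. bfun_apply f x \<le> c) \<Longrightarrow> bsup f \<le> c"
  unfolding bsup_def by (rule cSUP_least) auto

lemma sublinear_bsup: "sublinear (bsup :: 'a bfun \<Rightarrow> real)"
proof (rule sublinearI)
  show "bsup (f + g) \<le> bsup f + bsup g" for f g :: "'a bfun"
    by (rule bsup_least) (simp add: add_mono bfun_le_bsup)
  show "bsup (0 :: 'a bfun) = 0"
    by (simp add: bsup_def)
  show "bsup (c *\<^sub>R f) \<le> c * bsup f" if "c > 0" for c and f :: "'a bfun"
    using that by (intro bsup_least) (simp add: bfun_le_bsup)
qed

lemma bsup_lshift: "bsup (lshift g f) = bsup f"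
proof (rule antisym)
  show le: "bsup (lshift g f) \<le> bsup f" for g f
    by (rule bsup_least) (simp add: bfun_le_bsup)
  show "bsup f \<le> bsup (lshift g f)"
    using le[of "- g" "lshift g f"] by (simp add: lshift_lshift)
qed

locale minimal_invariant =
  fixes p :: "'g::group_add bfun \<Rightarrow> real"
  assumes sublin: "sublinear p"
    and le_bsup: "p f \<le> bsup f"
    and inv: "p (lshift g f) = p f"
    and minimal: "\<And>q f. \<lbrakk>sublinear q; \<And>f. q f \<le> p f; \<And>g f. q (lshift g f) = q f\<rbrakk> \<Longrightarrow> q f = p f"

lemma minimal_invariant_exists: "\<exists>p :: 'g::group_add bfun \<Rightarrow> real. minimal_invariant p"
proof (rule minimal_sublinear[OF sublinear_bsup, of "range lshift"])
  fix p :: "'g bfun \<Rightarrow> real"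
  assume p: "sublinear p" "\<And>f. p f \<le> bsup f" "\<And>l f. l \<in> range lshift \<Longrightarrow> p (l f) = p f"
    "\<And>q f. \<lbrakk>sublinear q; \<And>f. q f \<le> p f; \<And>l f. l \<in> range lshift \<Longrightarrow> q (l f) = q f\<rbrakk> \<Longrightarrow> q f = p f"
  have "minimal_invariant p"
  proof
    fix q f assume q: "sublinear q" "\<And>f. q f \<le> p f" "\<And>g f. q (lshift g f) = q f"
    have "q (l f) = q f" if "l \<in> range lshift" for l f
      using that q(3) by blast
    then show "q f = p f" by (rule p(4)[OF q(1,2)])
  qed (use p(1-3) in blast)+
  then show ?thesis by blast
qed (use bsup_lshift in blast)

section \<open>The Poisson transform of a mean below the minimal functional\<close>

context minimal_invariant
begin

lemma p_ge: "(\<And>x. c \<le> bfun_apply f x) \<Longrightarrow> c \<le> p f"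
  using le_bsup[of "- f"] bsup_least[of "- f" "- c"] sublinear_uminus[OF sublin, of f] by fastforce

context
  fixes m :: "'g bfun \<Rightarrow> real"
  assumes m: "linear m" and m_le: "m f \<le> p f"
begin

lemma bounded_poisson: "bounded (range (\<lambda>x. m (lshift x f)))"
proof -
  have "\<bar>m (lshift x f)\<bar> \<le> \<bar>p f\<bar> + \<bar>p (- f)\<bar>" for x
  proof -
    have "m (lshift x f) \<le> p f"
      using m_le[of "lshift x f"] by (simp add: inv)
    moreover have "- m (lshift x f) \<le> p (- f)"
      using m_le[of "lshift x (- f)"] unfolding inv by (simp add: linear_neg[OF m] linear_neg[OF linear_lshift])
    ultimately show ?thesis by linarith
  qed
  then show ?thesis
    by (intro boundedI[of _ "\<bar>p f\<bar> + \<bar>p (- f)\<bar>"]) auto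
qed

text \<open>The orbit of the mean \<open>m\<close>, seen as a function on the group. The transform
  commutes with translations and keeps the upper bound \<open>p f\<close>.\<close>

definition poisson :: "'g bfun \<Rightarrow> 'g bfun" where
  "poisson f = Abs_bfun (\<lambda>x. m (lshift x f))"

lemma poisson_apply: "bfun_apply (poisson f) x = m (lshift x f)"
  unfolding poisson_def by (subst Abs_bfun_inverse) (simp_all add: bounded_poisson)

lemma linear_poisson: "linear poisson"
  by (intro linearI bfun_eqI)
     (simp_all add: poisson_apply linear_add[OF m] linear_scale[OF m] linear_add[OF linear_lshift]
       linear_scale[OF linear_lshift])

lemma poisson_lshift: "poisson (lshift g f) = lshift g (poisson f)"
  by (rule bfun_eqI) (simp add: poisson_apply lshift_lshift)

lemma poisson_le: "bfun_apply (poisson f) x \<le> p f"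
  using m_le[of "lshift x f"] by (simp add: poisson_apply inv)

text \<open>This is where minimality enters. If no average were at least \<open>\<beta>\<close>
  everywhere, subtracting nonnegative multiples of \<open>k - bconst \<beta>\<close> would produce
  an invariant sublinear functional below \<open>p\<close> that is strictly smaller at
  \<open>h\<close>.\<close>

lemma poisson_averages:
  assumes \<beta>: "\<beta> < p h"
  shows "\<exists>k\<in>convex hull (range (\<lambda>s. lshift s (poisson h))). \<forall>x. \<beta> \<le> bfun_apply k x"
proof (rule ccontr)
  define K where "K = convex hull (range (\<lambda>s. lshift s (poisson h)))"
  assume "\<not> ?thesis"
  then have K_less: "\<exists>x. bfun_apply k x < \<beta>" if "k \<in> K" for k
    using that by (auto simp: K_def not_le)
  have K_poisson: "poisson h \<in> K"
    unfolding K_def by (rule hull_inc) (auto intro: range_eqI[of _ _ 0])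
  have K_lshift: "lshift g k \<in> K" if "k \<in> K" for g k
  proof -
    have "lshift g ` K = convex hull (lshift g ` range (\<lambda>s. lshift s (poisson h)))"
      unfolding K_def by (rule convex_hull_linear_image[OF linear_lshift])
    also have "\<dots> \<subseteq> K"
      unfolding K_def by (rule hull_mono) (auto simp: lshift_lshift)
    finally show ?thesis using that by blast
  qed
  define v where "v f = (\<lambda>(c, k). bsup (poisson f - c *\<^sub>R (k - bconst \<beta>)))" for f
  define C where "C = {0::real..} \<times> K"
  \<comment> \<open>\<open>c = 0\<close> gives at most \<open>p f\<close>; \<open>c = 1\<close> and
    \<open>k = poisson h\<close> give at most \<open>\<beta>\<close> at \<open>h\<close>. The
    assumed failure keeps the infimum finite: each \<open>k\<close> is below \<open>\<beta>\<close>
    at some point, and there subtracting the multiple can only raise the value.\<close>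
  define q where "q f = (INF z\<in>C. v f z)" for f
  have lower: "- p (- f) \<le> v f (c, k)" if ck: "c \<ge> 0" "k \<in> K" for f c k
  proof -
    obtain x where x: "bfun_apply k x < \<beta>" using K_less[OF ck(2)] by blast
    have "- p (- f) \<le> bfun_apply (poisson f) x"
      using poisson_le[of "- f" x] linear_neg[OF linear_poisson, of f] by simp
    also have "\<dots> \<le> bfun_apply (poisson f - c *\<^sub>R (k - bconst \<beta>)) x"
      using x \<open>c \<ge> 0\<close> by (simp add: mult_nonneg_nonpos)
    also have "\<dots> \<le> v f (c, k)"
      unfolding v_def prod.case by (rule bfun_le_bsup)
    finally show ?thesis .
  qed
  have bdd: "bdd_below (v f ` C)" for f
    using lower by (intro bdd_belowI2[of _ "- p (- f)"]) (auto simp: C_def)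
  have q_le: "q f \<le> v f (c, k)" if "c \<ge> 0" "k \<in> K" for f c k
    unfolding q_def using that by (intro cINF_lower[OF bdd]) (simp add: C_def)
  have q_ge: "d \<le> q f" if "\<And>c k. c \<ge> 0 \<Longrightarrow> k \<in> K \<Longrightarrow> d \<le> v f (c, k)" for f d
    unfolding q_def using that K_poisson by (intro cINF_greatest) (auto simp: C_def)
  have "sublinear q"
  proof (rule sublinearI)
    fix f g :: "'g bfun" and d :: real
    have *: "q (f + g) \<le> v f (c, k) + v g (c', k')" if ck: "c \<ge> 0" "k \<in> K" "c' \<ge> 0" "k' \<in> K" for c k c' k'
    proof -
      \<comment> \<open>The cone over the convex set \<open>K\<close> is closed under addition; if
        both coefficients vanish, any element of \<open>K\<close> serves.\<close>
      obtain k'' where k'': "k'' \<in> K" "(c + c') *\<^sub>R k'' = c *\<^sub>R k + c' *\<^sub>R k'"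
      proof (cases "c + c' = 0")
        case True
        then have "c = 0" "c' = 0" using ck by auto
        then show thesis using that[of k] ck by simp
      next
        case False
        then have "(c / (c + c')) *\<^sub>R k + (c' / (c + c')) *\<^sub>R k' \<in> K"
          using ck unfolding K_def
          by (intro convexD[OF convex_convex_hull]) (auto simp flip: add_divide_distrib)
        then show thesis
          using False that[of "(c / (c + c')) *\<^sub>R k + (c' / (c + c')) *\<^sub>R k'"] by (simp add: scaleR_add_right)
      qed
      have "q (f + g) \<le> v (f + g) (c + c', k'')"
        using ck k'' by (intro q_le) auto
      also have "\<dots> = bsup ((poisson f - c *\<^sub>R (k - bconst \<beta>)) + (poisson g - c' *\<^sub>R (k' - bconst \<beta>)))"
      proof -
        have "(c + c') *\<^sub>R (k'' - bconst \<beta>) = c *\<^sub>R (k - bconst \<beta>) + c' *\<^sub>R (k' - bconst \<beta>)"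
          by (simp add: scaleR_diff_right k''(2)) (simp add: algebra_simps)
        then show ?thesis
          by (simp add: v_def linear_add[OF linear_poisson] algebra_simps)
      qed
      also have "\<dots> \<le> v f (c, k) + v g (c', k')"
        unfolding v_def prod.case by (rule sublinear_add[OF sublinear_bsup])
      finally show ?thesis .
    qed
    have "q (f + g) - v f (c, k) \<le> q g" if "c \<ge> 0" "k \<in> K" for c k
      using *[OF that] by (intro q_ge) (simp add: algebra_simps)
    then have "q (f + g) - q g \<le> q f"
      by (intro q_ge) (simp add: algebra_simps)
    then show "q (f + g) \<le> q f + q g" by simp
    have "0 \<le> q 0"
      using lower[of _ _ 0] by (intro q_ge) (simp add: sublinear_zero[OF sublin])
    then show "q 0 = 0"
      using q_le[of 0 "poisson h" 0] K_poisson
      by (simp add: v_def linear_0[OF linear_poisson] sublinear_zero[OF sublinear_bsup])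
    assume d: "d > 0"
    have "q (d *\<^sub>R f) / d \<le> q f"
    proof (rule q_ge)
      fix c :: real and k assume ck: "c \<ge> 0" "k \<in> K"
      have "q (d *\<^sub>R f) \<le> v (d *\<^sub>R f) (d * c, k)"
        using ck d by (intro q_le) auto
      also have "\<dots> = bsup (d *\<^sub>R (poisson f - c *\<^sub>R (k - bconst \<beta>)))"
        by (simp add: v_def linear_scale[OF linear_poisson] scaleR_diff_right)
      also have "\<dots> = d * v f (c, k)"
        using d by (simp add: v_def sublinear_scaleR[OF sublinear_bsup])
      finally show "q (d *\<^sub>R f) / d \<le> v f (c, k)"
        using d by (simp add: field_simps)
    qed
    then show "q (d *\<^sub>R f) \<le> d * q f"
      using d by (simp add: field_simps)
  qed
  moreover have "q f \<le> p f" for f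
  proof -
    have "q f \<le> v f (0, poisson h)"
      using K_poisson by (intro q_le) auto
    also have "\<dots> \<le> p f"
      by (simp add: v_def bsup_least poisson_le)
    finally show ?thesis .
  qed
  moreover have "q (lshift g f) = q f" for g f
  proof (rule antisym)
    show le: "q (lshift g f) \<le> q f" for g f
    proof (rule q_ge)
      fix c :: real and k assume ck: "c \<ge> 0" "k \<in> K"
      have "q (lshift g f) \<le> v (lshift g f) (c, lshift g k)"
        using ck by (intro q_le K_lshift) auto
      also have "\<dots> = bsup (lshift g (poisson f - c *\<^sub>R (k - bconst \<beta>)))"
        unfolding v_def prod.case by (intro arg_cong[of _ _ bsup] bfun_eqI) (simp add: poisson_lshift)
      finally show "q (lshift g f) \<le> v f (c, k)"
        by (simp add: v_def bsup_lshift)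
    qed
    show "q f \<le> q (lshift g f)"
      using le[of "- g" "lshift g f"] by (simp add: lshift_lshift)
  qed
  ultimately have "q h = p h"
    by (rule minimal)
  moreover have "q h \<le> v h (1, poisson h)"
    using K_poisson by (intro q_le) auto
  moreover have "v h (1, poisson h) \<le> \<beta>"
    by (simp add: v_def bsup_least)
  ultimately show False using \<beta> by simp
qed

end

text \<open>
  If \<open>h\<close> and its translate cannot both be close to their supremum, then the set on which the Poisson
  transform of \<open>h\<close> almost attains its supremum is disjoint from its translate, and by Chebyshev's
  inequality an average of its translates is almost \<open>1\<close> everywhere.
\<close>

lemma displaced_set:
  assumes h: "p (h + lshift t h) < 2 * p h" and \<epsilon>: "\<epsilon> > 0"
  obtains E n and u :: "nat \<Rightarrow> real" and s where
    "\<And>x. x \<in> E \<Longrightarrow> t + x \<notin> E" "\<And>i. i \<in> {1..n} \<Longrightarrow> 0 \<le> u i" "(\<Sum>i=1..n. u i) = 1"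
    "\<And>x. (\<Sum>i=1..n. u i * of_bool (s i + x \<notin> E)) \<le> \<epsilon>"
proof -
  obtain m where m: "linear m" "\<And>f. m f \<le> p f"
    using linear_below_sublinear[OF sublin] by blast
  define \<psi> where "\<psi> = bfun_apply (poisson m h)"
  \<comment> \<open>Half the gap: if \<open>x\<close> and \<open>t + x\<close> both lay in
    \<open>E\<close>, the two values of \<open>\<psi>\<close> would add up to more than
    \<open>2 * p h - 2 * \<delta>\<close>, which is the upper bound
    \<open>p (h + lshift t h)\<close>.\<close>
  define \<delta> where "\<delta> = (2 * p h - p (h + lshift t h)) / 2"
  have \<delta>: "\<delta> > 0" using h by (simp add: \<delta>_def)
  define E where "E = {x. \<psi> x > p h - \<delta>}"
  have \<psi>: "\<psi> x = m (lshift x h)" for x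
    by (simp add: \<psi>_def poisson_apply[OF m])
  have \<psi>_le: "\<psi> x \<le> p h" for x
    unfolding \<psi>_def by (rule poisson_le[OF m])
  \<comment> \<open>An average deficit of at most \<open>\<epsilon> * \<delta>\<close> leaves weight
    at most \<open>\<epsilon>\<close> on the terms outside \<open>E\<close>, whose deficit is at
    least \<open>\<delta>\<close>.\<close>
  have "p h - \<epsilon> * \<delta> < p h"
    using \<epsilon> \<delta> by simp
  from poisson_averages[OF m this] obtain k where
    "k \<in> convex hull (range (\<lambda>s. lshift s (poisson m h)))" and k_ge: "\<And>x. p h - \<epsilon> * \<delta> \<le> bfun_apply k x"
    by blast
  then obtain n and u :: "nat \<Rightarrow> real" and y where
    u: "\<And>i. i \<in> {1..n} \<Longrightarrow> 0 \<le> u i" "(\<Sum>i=1..n. u i) = 1"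
    and y: "\<And>i. i \<in> {1..n} \<Longrightarrow> y i \<in> range (\<lambda>s. lshift s (poisson m h))" and k: "(\<Sum>i=1..n. u i *\<^sub>R y i) = k"
    unfolding convex_hull_indexed by blast
  from y have "\<forall>i\<in>{1..n}. \<exists>s. y i = lshift s (poisson m h)"
    by blast
  then obtain s where s: "\<And>i. i \<in> {1..n} \<Longrightarrow> y i = lshift (s i) (poisson m h)"
    by metis
  have sum_apply: "bfun_apply (\<Sum>i\<in>I. f i) x = (\<Sum>i\<in>I. bfun_apply (f i) x)" for I :: "nat set" and f x
    by (induction I rule: infinite_finite_induct) auto
  have k_eq: "bfun_apply k x = (\<Sum>i=1..n. u i * \<psi> (s i + x))" for x
    unfolding k[symmetric] sum_apply by (rule sum.cong) (simp_all add: s \<psi>_def)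
  show thesis
  proof
    show "t + x \<notin> E" if "x \<in> E" for x
    proof
      assume "t + x \<in> E"
      have "\<psi> x + \<psi> (t + x) = m (lshift x (h + lshift t h))"
        by (simp add: \<psi> linear_add[OF m(1)] linear_add[OF linear_lshift] lshift_lshift)
      also have "\<dots> \<le> p (h + lshift t h)"
        using m(2) inv by metis
      finally show False
        using \<open>t + x \<in> E\<close> that by (simp add: E_def \<delta>_def field_simps)
    qed
    show "(\<Sum>i=1..n. u i * of_bool (s i + x \<notin> E)) \<le> \<epsilon>" for x
    proof -
      have "(\<Sum>i=1..n. u i * (\<delta> * of_bool (s i + x \<notin> E))) \<le> (\<Sum>i=1..n. u i * (p h - \<psi> (s i + x)))"
        using u \<psi>_le by (intro sum_mono mult_left_mono) (auto simp: E_def of_bool_def)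
      also have "\<dots> = p h * (\<Sum>i=1..n. u i) - bfun_apply k x"
        by (simp add: k_eq right_diff_distrib sum_subtractf sum_distrib_left mult.commute)
      also have "\<dots> = p h - bfun_apply k x"
        unfolding u(2) by simp
      also have "\<dots> \<le> \<epsilon> * \<delta>"
        using k_ge[of x] by simp
      finally have "\<delta> * (\<Sum>i=1..n. u i * of_bool (s i + x \<notin> E)) \<le> \<delta> * \<epsilon>"
        unfolding sum_distrib_left by (simp only: mult_ac)
      then show ?thesis using \<delta> by simp
    qed
  qed (use u in auto)
qed

text \<open>
  Otherwise the hypothesis passes from \<open>t\<close> to \<open>t + t\<close>, so that \<open>p (lshift t f - f)\<close> at least doubles
  when \<open>t\<close> is doubled; it is bounded, hence not positive.
\<close>

lemma lshift_fixes:
  assumes t: "\<And>h. 2 * p h \<le> p (h + lshift t h)"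
  shows "p (lshift t f - f) \<le> 0"
proof (rule ccontr)
  note p_add = sublinear_add[OF sublin]
  define D where "D u = p (lshift u f - f)" for u
  assume "\<not> ?thesis"
  then have D: "D t > 0" by (simp add: D_def)
  have D_le: "D u \<le> p f + p (- f)" for u
    using p_add[of "lshift u f" "- f"] by (simp add: D_def inv)
  have "\<exists>u. (\<forall>h. 2 * p h \<le> p (h + lshift u h)) \<and> 2 ^ n * D t \<le> D u" for n
  proof (induction n)
    case 0
    then show ?case using t by (intro exI[of _ t]) auto
  next
    case (Suc n)
    then obtain u where u: "\<And>h. 2 * p h \<le> p (h + lshift u h)" "2 ^ n * D t \<le> D u" by blast
    have "2 * p h \<le> p (h + lshift (u + u) h)" for h
    proof -
      \<comment> \<open>Using the hypothesis twice gives the factor 4; the two cross terms coincide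
        and take back exactly \<open>2 * p h\<close>.\<close>
      have "4 * p h \<le> 2 * p (h + lshift u h)"
        using u(1)[of h] by simp
      also have "\<dots> \<le> p ((h + lshift u h) + lshift u (h + lshift u h))"
        by (rule u(1))
      also have "(h + lshift u h) + lshift u (h + lshift u h) = (h + lshift (u + u) h) + 2 *\<^sub>R lshift u h"
        by (rule bfun_eqI) (simp add: add.assoc)
      also have "p \<dots> \<le> p (h + lshift (u + u) h) + p (2 *\<^sub>R lshift u h)"
        by (rule p_add)
      also have "p (2 *\<^sub>R lshift u h) = 2 * p h"
        by (simp add: sublinear_scaleR[OF sublin] inv)
      finally show ?thesis by simp
    qed
    moreover have "2 ^ Suc n * D t \<le> D (u + u)"
    proof -
      have "2 ^ Suc n * D t \<le> 2 * D u"
        using u(2) by simp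
      also have "\<dots> \<le> p ((lshift u f - f) + lshift u (lshift u f - f))"
        unfolding D_def by (rule u(1))
      also have "(lshift u f - f) + lshift u (lshift u f - f) = lshift (u + u) f - f"
        by (rule bfun_eqI) (simp add: add.assoc)
      finally show ?thesis by (simp add: D_def)
    qed
    ultimately show ?case by blast
  qed
  then have le: "2 ^ n * D t \<le> p f + p (- f)" for n
    using D_le by (meson order_trans)
  obtain n where "(p f + p (- f)) / D t < 2 ^ n"
    using real_arch_pow[of 2 "(p f + p (- f)) / D t"] by auto
  with le[of n] D show False
    by (simp add: field_simps)
qed

text \<open>The inequality for \<open>- f\<close> is the reverse one, so every linear functional
  below \<open>p\<close> agrees on \<open>f\<close> and \<open>lshift g f\<close>: this is the
  kernel of the action on those functionals.\<close>

definition stabilizer :: "'g set" where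
  "stabilizer = {g. \<forall>f. p (lshift g f - f) \<le> 0}"

lemma stabilizer_zero: "0 \<in> stabilizer"
  by (simp add: stabilizer_def sublinear_zero[OF sublin])

lemma stabilizer_add:
  assumes "g \<in> stabilizer" "h \<in> stabilizer"
  shows "g + h \<in> stabilizer"
  unfolding stabilizer_def mem_Collect_eq
proof
  fix f
  have "p (lshift (g + h) f - f) = p ((lshift h (lshift g f) - lshift g f) + (lshift g f - f))"
    by (simp add: lshift_lshift)
  also have "\<dots> \<le> p (lshift h (lshift g f) - lshift g f) + p (lshift g f - f)"
    by (rule sublinear_add[OF sublin])
  also have "\<dots> \<le> 0 + 0"
    using assms by (intro add_mono) (auto simp: stabilizer_def)
  finally show "p (lshift (g + h) f - f) \<le> 0" by simp
qed

lemma stabilizer_uminus: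
  assumes "g \<in> stabilizer"
  shows "- g \<in> stabilizer"
  unfolding stabilizer_def mem_Collect_eq
proof
  fix f
  have "p (lshift (- g) f - f) = p (lshift g (lshift (- g) f - f))"
    by (simp add: inv)
  also have "lshift g (lshift (- g) f - f) = lshift g (- f) - (- f)"
    by (rule bfun_eqI) (simp flip: add.assoc)
  also have "p \<dots> \<le> 0"
    using assms unfolding stabilizer_def by blast
  finally show "p (lshift (- g) f - f) \<le> 0" .
qed

text \<open>Normality comes from the invariance of \<open>p\<close>: translating by \<open>s\<close>
  inside \<open>p\<close> turns the difference for the conjugate and \<open>f\<close> into the
  difference for \<open>g\<close> and \<open>lshift s f\<close>.\<close>

lemma stabilizer_conj:
  assumes "g \<in> stabilizer"
  shows "s + g - s \<in> stabilizer"
  unfolding stabilizer_def mem_Collect_eq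
proof
  fix f
  have "p (lshift (s + g - s) f - f) = p (lshift s (lshift (s + g - s) f - f))"
    by (simp add: inv)
  also have "lshift s (lshift (s + g - s) f - f) = lshift g (lshift s f) - lshift s f"
    by (rule bfun_eqI) (simp flip: add.assoc)
  also have "p \<dots> \<le> 0"
    using assms by (simp add: stabilizer_def)
  finally show "p (lshift (s + g - s) f - f) \<le> 0" .
qed

end

section \<open>The Hilbert space and its adjoints\<close>

lemmas ell2_nth_simps [simp] =
  zero_ell2.rep_eq plus_ell2.rep_eq uminus_ell2.rep_eq minus_ell2.rep_eq scaleR_ell2.rep_eq
  scaleC_ell2.rep_eq translate.rep_eq

lemma ell2_eqI: "(\<And>i. ell2_nth x i = ell2_nth y i) \<Longrightarrow> x = y"
  by (simp add: ell2_nth_inject[symmetric] fun_eq_iff)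

lemma ell2_summable: "(\<lambda>i. (cmod (ell2_nth x i))\<^sup>2) summable_on UNIV"
  using ell2_nth[of x] by simp

lemma norm_ell2_square: "(norm x)\<^sup>2 = (\<Sum>\<^sub>\<infinity>i. (cmod (ell2_nth x i))\<^sup>2)"
  by (simp add: norm_ell2.rep_eq infsum_nonneg)

lemma ell2_sum_le:
  assumes "finite S"
  shows "(\<Sum>i\<in>S. (cmod (ell2_nth x i))\<^sup>2) \<le> (norm x)\<^sup>2"
  unfolding norm_ell2_square
  by (rule finite_sum_le_infsum[OF ell2_summable assms]) auto

lemma ell2_nth_le_norm: "cmod (ell2_nth x i) \<le> norm x"
  using ell2_sum_le[of "{i}" x] by (intro power2_le_imp_le[OF _ norm_ge_zero]) simp

lemma ell2_of_finite_sums: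
  assumes C: "C \<ge> 0" and le: "\<And>S. finite S \<Longrightarrow> (\<Sum>i\<in>S. (cmod (f i))\<^sup>2) \<le> C\<^sup>2"
  obtains x where "ell2_nth x = f" "norm x \<le> C"
proof -
  have f: "(\<lambda>i. (cmod (f i))\<^sup>2) summable_on UNIV"
    using le by (intro nonneg_bdd_above_summable_on bdd_aboveI2[of _ _ "C\<^sup>2"]) auto
  then have nth: "ell2_nth (Abs_ell2 f) = f"
    by (simp add: Abs_ell2_inverse)
  have "(norm (Abs_ell2 f))\<^sup>2 \<le> C\<^sup>2"
    unfolding norm_ell2_square nth by (rule infsum_le_finite_sums[OF f]) (use le in auto)
  then show thesis
    by (rule that[OF nth power2_le_imp_le[OF _ C]])
qed

instance ell2 :: (type) banach
proof
  fix X :: "nat \<Rightarrow> 'a ell2"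
  assume X: "Cauchy X"
  have "Cauchy (\<lambda>n. ell2_nth (X n) i)" for i
  proof (rule metric_CauchyI)
    fix e :: real assume "e > 0"
    then obtain M where M: "\<And>m n. m \<ge> M \<Longrightarrow> n \<ge> M \<Longrightarrow> dist (X m) (X n) < e"
      using metric_CauchyD[OF X] by blast
    have "dist (ell2_nth (X m) i) (ell2_nth (X n) i) < e" if "m \<ge> M" "n \<ge> M" for m n
      using M[OF that] ell2_nth_le_norm[of "X m - X n" i] by (simp add: dist_norm)
    then show "\<exists>M. \<forall>m\<ge>M. \<forall>n\<ge>M. dist (ell2_nth (X m) i) (ell2_nth (X n) i) < e" by blast
  qed
  then have "\<exists>l. (\<lambda>n. ell2_nth (X n) i) \<longlonglongrightarrow> l" for i
    by (simp add: Cauchy_convergent_iff convergent_def)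
  then obtain f where f: "\<And>i. (\<lambda>n. ell2_nth (X n) i) \<longlonglongrightarrow> f i"
    by metis
  \<comment> \<open>The pointwise limit \<open>f\<close> is not yet known to be square-summable. Its
    difference to a late term is, by passing to the limit in finite sums, and the limit vector is
    then assembled as \<open>y + X M\<close>.\<close>
  have diff: "\<exists>y. ell2_nth y = (\<lambda>i. f i - ell2_nth (X n) i) \<and> norm y \<le> e"
    if e: "e \<ge> 0" and n: "\<And>m. m \<ge> M \<Longrightarrow> dist (X m) (X n) \<le> e" for n e M
  proof -
    have "(\<Sum>i\<in>S. (cmod (f i - ell2_nth (X n) i))\<^sup>2) \<le> e\<^sup>2" if "finite S" for S
    proof (rule Lim_bounded)
      show "(\<lambda>m. \<Sum>i\<in>S. (cmod (ell2_nth (X m) i - ell2_nth (X n) i))\<^sup>2)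
        \<longlonglongrightarrow> (\<Sum>i\<in>S. (cmod (f i - ell2_nth (X n) i))\<^sup>2)"
        by (intro tendsto_intros f)
      show "\<forall>m\<ge>M. (\<Sum>i\<in>S. (cmod (ell2_nth (X m) i - ell2_nth (X n) i))\<^sup>2) \<le> e\<^sup>2"
      proof (intro allI impI)
        fix m assume "m \<ge> M"
        then have "(norm (X m - X n))\<^sup>2 \<le> e\<^sup>2"
          using n by (intro power_mono) (auto simp: dist_norm)
        then show "(\<Sum>i\<in>S. (cmod (ell2_nth (X m) i - ell2_nth (X n) i))\<^sup>2) \<le> e\<^sup>2"
          using ell2_sum_le[OF that, of "X m - X n"] by simp
      qed
    qed
    then show ?thesis
      by (rule ell2_of_finite_sums[OF e]) (blast, intro exI conjI)
  qed
  obtain M where M: "\<And>m n. m \<ge> M \<Longrightarrow> n \<ge> M \<Longrightarrow> dist (X m) (X n) < 1"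
    using metric_CauchyD[OF X zero_less_one] by blast
  obtain y where y: "ell2_nth y = (\<lambda>i. f i - ell2_nth (X M) i)"
    using diff[OF zero_le_one less_imp_le[OF M[OF _ order_refl]]] by blast
  have "X \<longlonglongrightarrow> y + X M"
  proof (rule metric_LIMSEQ_I)
    fix e :: real assume "e > 0"
    then obtain K where K: "\<And>m n. m \<ge> K \<Longrightarrow> n \<ge> K \<Longrightarrow> dist (X m) (X n) < e / 2"
      using metric_CauchyD[OF X, of "e / 2"] by auto
    have "dist (X n) (y + X M) < e" if n: "n \<ge> K" for n
    proof -
      have e: "0 \<le> e / 2" using \<open>e > 0\<close> by simp
      obtain z where z: "ell2_nth z = (\<lambda>i. f i - ell2_nth (X n) i)" "norm z \<le> e / 2"
        using diff[OF e less_imp_le[OF K[OF _ n]]] by blast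
      have "X n - (y + X M) = - z"
        by (rule ell2_eqI) (simp add: y z)
      then show ?thesis
        using z \<open>e > 0\<close> by (simp add: dist_norm)
    qed
    then show "\<exists>K. \<forall>n\<ge>K. dist (X n) (y + X M) < e" by blast
  qed
  then show "convergent X"
    by (rule convergentI)
qed

lemma cinner_add_right: "cinner x (y + z) = cinner x y + cinner x z"
  by (metis cinner_add_left_ell2 cinner_commute complex_cnj_add)

lemma cinner_scaleC_right: "cinner x (c *\<^sub>C y) = cnj c * cinner x y"
  by (metis cinner_commute cinner_scaleC_left complex_cnj_mult)

lemma scaleC_minus_one: "(-1) *\<^sub>C x = - x"
  by (rule ell2_eqI) simp

lemma cinner_diff_left: "cinner (x - y) z = cinner x z - cinner y z"
  using cinner_add_left_ell2[of x "(-1) *\<^sub>C y" z] unfolding cinner_scaleC_left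
  by (simp add: scaleC_minus_one)

lemma cinner_diff_right: "cinner z (x - y) = cinner z x - cinner z y"
  using cinner_add_right[of z x "(-1) *\<^sub>C y"] unfolding cinner_scaleC_right
  by (simp add: scaleC_minus_one)

lemma cmod_cinner_le: "cmod (cinner x y) \<le> norm x * norm y"
proof (cases "cinner x y = 0")
  case False
  \<comment> \<open>A phase that rotates the inner product onto its modulus, so that the real
    Cauchy-Schwarz inequality applies.\<close>
  define c where "c = cnj (cinner x y) / cmod (cinner x y)"
  have c: "cmod c = 1"
    using False by (simp add: c_def norm_divide)
  have "c * cinner x y = cmod (cinner x y)"
    using False by (simp add: c_def mult.commute flip: complex_norm_square) (simp add: power2_eq_square)
  then have "cmod (cinner x y) = inner (c *\<^sub>C x) y"
    by (simp add: inner_ell2_def cinner_scaleC_left)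
  also have "\<dots> \<le> norm (c *\<^sub>C x) * norm y"
    by (rule norm_cauchy_schwarz)
  finally show ?thesis
    by (simp add: norm_scaleC_ell2 c)
qed simp

text \<open>A relation instead of \<open>adj\<close>, because a definite description says something
  only once an adjoint is known to exist, and existence is obtained below by building up this
  relation.\<close>

definition is_adj :: "('a ell2 \<Rightarrow>\<^sub>L 'a ell2) \<Rightarrow> ('a ell2 \<Rightarrow>\<^sub>L 'a ell2) \<Rightarrow> bool" where
  "is_adj a b \<longleftrightarrow> (\<forall>x y. cinner (a x) y = cinner x (b y))"

lemma is_adjD: "is_adj a b \<Longrightarrow> cinner (a x) y = cinner x (b y)"
  by (simp add: is_adj_def)

lemma adj_eq: "is_adj a b \<Longrightarrow> adj a = b"
  by (rule adj_eqI) (simp add: is_adj_def)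

lemma is_adj_sym: "is_adj a b \<Longrightarrow> is_adj b a"
  unfolding is_adj_def by (metis cinner_commute)

lemma is_adj_lreg: "is_adj (lreg t) (lreg (- t))"
  unfolding is_adj_def
proof (intro allI)
  fix x y :: "'a ell2"
  have "bij_betw (\<lambda>s. t + s) UNIV UNIV"
    by (auto intro!: bij_betw_byWitness[where f' = "\<lambda>s. - t + s"] simp flip: add.assoc)
  from infsum_reindex_bij_betw[OF this, of "\<lambda>s. ell2_nth x (- t + s) * cnj (ell2_nth y s)"]
  show "cinner (lreg t x) y = cinner x (lreg (- t) y)"
    by (simp add: cinner.rep_eq lreg_apply flip: add.assoc)
qed

lemma is_adj_add: "is_adj a b \<Longrightarrow> is_adj c d \<Longrightarrow> is_adj (a + c) (b + d)"
  by (simp add: is_adj_def blinfun.add_left cinner_add_left_ell2 cinner_add_right)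

lemma is_adj_diff: "is_adj a b \<Longrightarrow> is_adj c d \<Longrightarrow> is_adj (a - c) (b - d)"
  by (simp add: is_adj_def blinfun.diff_left cinner_diff_left cinner_diff_right)

lemma is_adj_scaleC: "is_adj a b \<Longrightarrow> is_adj (scaleC_op c a) (scaleC_op (cnj c) b)"
  by (simp add: is_adj_def scaleC_op_apply cinner_scaleC_left cinner_scaleC_right)

lemma is_adj_compose: "is_adj a b \<Longrightarrow> is_adj c d \<Longrightarrow> is_adj (a o\<^sub>L c) (d o\<^sub>L b)"
  by (simp add: is_adj_def)

lemma is_adj_id: "is_adj id_blinfun id_blinfun"
  by (simp add: is_adj_def)

lemma is_adj_norm:
  assumes "is_adj a b"
  shows "norm b \<le> norm a"
proof (rule norm_blinfun_bound)
  fix y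
  have "(norm (b y))\<^sup>2 = cmod (cinner (b y) (b y))"
    by (simp add: cinner_self_ell2 norm_power)
  also have "\<dots> = cmod (cinner (a (b y)) y)"
    using assms by (simp add: is_adj_def)
  also have "\<dots> \<le> norm (a (b y)) * norm y"
    by (rule cmod_cinner_le)
  also have "\<dots> \<le> norm a * norm (b y) * norm y"
    by (intro mult_right_mono norm_blinfun) simp
  finally have "norm (b y) * norm (b y) \<le> norm (b y) * (norm a * norm y)"
    by (simp add: power2_eq_square mult_ac)
  then show "norm (b y) \<le> norm a * norm y"
    by (cases "norm (b y) = 0") (auto simp: mult_le_cancel_left)
qed simp

lemma bounded_linear_cinner_left: "bounded_linear (\<lambda>x. cinner x y)"
  by (rule bounded_linear_intro[of _ "norm y"])
     (simp_all add: cinner_add_left_ell2 scaleR_ell2_scaleC cinner_scaleC_left cmod_cinner_le scaleR_conv_of_real)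

lemma bounded_linear_cinner_right: "bounded_linear (\<lambda>y. cinner x y)"
  by (rule bounded_linear_intro[of _ "norm x"])
     (simp_all add: cinner_add_right scaleR_ell2_scaleC cinner_scaleC_right cmod_cinner_le scaleR_conv_of_real
       mult.commute[of _ "norm x"])

lemma is_adj_tendsto:
  assumes a: "a \<longlonglongrightarrow> a'" and b: "b \<longlonglongrightarrow> b'" and adj: "\<And>n. is_adj (a n) (b n)"
  shows "is_adj a' b'"
  unfolding is_adj_def
proof (intro allI)
  fix x y
  have "(\<lambda>n. cinner (a n x) y) \<longlonglongrightarrow> cinner (a' x) y"
    by (intro bounded_linear.tendsto[OF bounded_linear_cinner_left] blinfun.tendsto a tendsto_const)
  moreover have "(\<lambda>n. cinner (a n x) y) \<longlonglongrightarrow> cinner x (b' y)"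
    unfolding is_adjD[OF adj]
    by (intro bounded_linear.tendsto[OF bounded_linear_cinner_right] blinfun.tendsto b tendsto_const)
  ultimately show "cinner (a' x) y = cinner x (b' y)"
    by (rule LIMSEQ_unique)
qed

section \<open>The reduced group C*-algebra and its states\<close>

lemma bounded_linear_scaleC_op: "bounded_linear (scaleC_op c :: ('a ell2 \<Rightarrow>\<^sub>L 'a ell2) \<Rightarrow> _)"
proof (rule bounded_linear_intro[of _ "cmod c"])
  fix a :: "'a ell2 \<Rightarrow>\<^sub>L 'a ell2"
  show "norm (scaleC_op c a) \<le> norm a * cmod c"
  proof (rule norm_blinfun_bound)
    fix x
    have "norm (scaleC_op c a x) = cmod c * norm (a x)"
      by (simp add: scaleC_op_apply norm_scaleC_ell2)
    also have "\<dots> \<le> cmod c * (norm a * norm x)"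
      by (intro mult_left_mono norm_blinfun) simp
    finally show "norm (scaleC_op c a x) \<le> norm a * cmod c * norm x"
      by (simp add: mult_ac)
  qed simp
qed (auto intro: blinfun_eqI simp: scaleC_op_apply blinfun.add_left blinfun.scaleR_left op_vs.scale_right_distrib
      scaleC_ell2_scaleR)

lemma scaleR_op: "r *\<^sub>R a = scaleC_op (complex_of_real r) a"
  by (rule blinfun_eqI) (simp add: scaleC_op_apply blinfun.scaleR_left scaleR_ell2_scaleC)

lemma closed_reduced_Cstar: "closed reduced_Cstar"
  by (simp add: reduced_Cstar_def)

lemma lreg_in_reduced_Cstar: "lreg t \<in> reduced_Cstar"
  unfolding reduced_Cstar_def by (rule subsetD[OF closure_subset]) (rule op_vs.span_base, rule rangeI)

lemma id_in_reduced_Cstar: "id_blinfun \<in> reduced_Cstar"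
  using lreg_in_reduced_Cstar[of 0] by (simp add: lreg_zero)

lemma reduced_Cstar_scaleC:
  assumes "a \<in> reduced_Cstar"
  shows "scaleC_op c a \<in> reduced_Cstar"
proof -
  have "scaleC_op c ` closure (op_vs.span (range lreg)) \<subseteq> closure (op_vs.span (range lreg))"
  proof (rule image_closure_subset)
    show "scaleC_op c ` op_vs.span (range lreg) \<subseteq> closure (op_vs.span (range lreg))"
      by (auto intro!: subsetD[OF closure_subset] op_vs.span_scale)
  qed (simp_all add: linear_continuous_on bounded_linear_scaleC_op)
  with assms show ?thesis
    unfolding reduced_Cstar_def by blast
qed

lemma reduced_Cstar_add:
  assumes "a \<in> reduced_Cstar" "b \<in> reduced_Cstar"
  shows "a + b \<in> reduced_Cstar"
proof -
  obtain x y where "\<forall>n. x n \<in> op_vs.span (range lreg)" "x \<longlonglongrightarrow> a"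
    "\<forall>n. y n \<in> op_vs.span (range lreg)" "y \<longlonglongrightarrow> b"
    using assms unfolding reduced_Cstar_def closure_sequential by blast
  then have "\<forall>n. x n + y n \<in> op_vs.span (range lreg)" "(\<lambda>n. x n + y n) \<longlonglongrightarrow> a + b"
    by (auto intro: op_vs.span_add tendsto_add)
  then show ?thesis
    unfolding reduced_Cstar_def closure_sequential by (intro exI conjI)
qed

lemma reduced_Cstar_scaleR: "a \<in> reduced_Cstar \<Longrightarrow> r *\<^sub>R a \<in> reduced_Cstar"
  by (simp add: scaleR_op reduced_Cstar_scaleC)

lemma reduced_Cstar_diff: "a \<in> reduced_Cstar \<Longrightarrow> b \<in> reduced_Cstar \<Longrightarrow> a - b \<in> reduced_Cstar"
  using reduced_Cstar_add[of a "(-1) *\<^sub>R b"] reduced_Cstar_scaleR[of b "-1"] by simp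

text \<open>The hypotheses make the operators with \<open>P\<close> a closed complex subspace
  containing the generators (zero arises by scaling \<open>lreg 0\<close>), hence a superset of the
  closed span.\<close>

lemma reduced_Cstar_induct [consumes 1, case_names closed lreg add scaleC]:
  assumes "a \<in> reduced_Cstar" and closed: "closed {a. P a}" and lreg: "\<And>t. P (lreg t)"
    and add: "\<And>a b. P a \<Longrightarrow> P b \<Longrightarrow> P (a + b)" and scaleC: "\<And>c a. P a \<Longrightarrow> P (scaleC_op c a)"
  shows "P a"
proof -
  have "P 0"
    using scaleC[OF lreg[of 0], of 0] by simp
  then have "op_vs.subspace {a. P a}"
    by (auto intro!: op_vs.subspaceI add scaleC)
  then have "op_vs.span (range lreg) \<subseteq> {a. P a}"
    using lreg by (intro op_vs.span_minimal) auto
  then have "reduced_Cstar \<subseteq> {a. P a}"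
    unfolding reduced_Cstar_def by (intro closure_minimal closed)
  with assms(1) show ?thesis by blast
qed

lemma compose_id [simp]: "id_blinfun o\<^sub>L a = a" "a o\<^sub>L id_blinfun = a"
  by (rule blinfun_eqI, simp)+

lemmas compose_add_diff =
  bounded_bilinear.add_left[OF bounded_bilinear_blinfun_compose]
  bounded_bilinear.add_right[OF bounded_bilinear_blinfun_compose]
  bounded_bilinear.diff_left[OF bounded_bilinear_blinfun_compose]
  bounded_bilinear.diff_right[OF bounded_bilinear_blinfun_compose]

lemma reduced_Cstar_compose:
  assumes a: "a \<in> reduced_Cstar" and b: "b \<in> reduced_Cstar"
  shows "a o\<^sub>L b \<in> reduced_Cstar"
  using a
proof (induction rule: reduced_Cstar_induct)
  case closed
  show ?case
    using closed_reduced_Cstar by (rule continuous_closed_vimage[unfolded vimage_def])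
      (intro continuous_intros)
next
  case (lreg t)
  show ?case using b
  proof (induction rule: reduced_Cstar_induct)
    case closed
    show ?case
      using closed_reduced_Cstar by (rule continuous_closed_vimage[unfolded vimage_def])
        (intro continuous_intros)
  next
    case (lreg s)
    show ?case by (simp add: lreg_in_reduced_Cstar flip: lreg_add)
  next
    case (scaleC c a)
    \<comment> \<open>A scalar on the right factor must pass through the left one, and the operator
      type only promises real linearity. For a generator it can be checked from the formula, which
      is why the left factor is reduced to a generator first.\<close>
    have "lreg t o\<^sub>L scaleC_op c a = scaleC_op c (lreg t o\<^sub>L a)"
      by (rule blinfun_eqI, rule ell2_eqI) (simp add: scaleC_op_apply lreg_apply)
    with scaleC show ?case by (simp add: reduced_Cstar_scaleC)
  qed (simp add: compose_add_diff reduced_Cstar_add)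
next
  case (scaleC c a)
  have "scaleC_op c a o\<^sub>L b = scaleC_op c (a o\<^sub>L b)"
    by (rule blinfun_eqI) (simp add: scaleC_op_apply)
  with scaleC show ?case by (simp add: reduced_Cstar_scaleC)
qed (simp add: compose_add_diff reduced_Cstar_add)

text \<open>Adjoints are built from those of the generators by linearity and limits, since passing
  to the adjoint does not increase the norm. Unlike Riesz representation, this also keeps them
  inside the algebra.\<close>

lemma reduced_Cstar_adj:
  assumes "a \<in> reduced_Cstar"
  shows "\<exists>b\<in>reduced_Cstar. is_adj a b"
  using assms
proof (induction rule: reduced_Cstar_induct)
  case closed
  show ?case
    unfolding closed_sequential_limits
  proof (intro allI impI, elim conjE)
    fix a a' assume a: "\<forall>n. a n \<in> {a. \<exists>b\<in>reduced_Cstar. is_adj a b}" "a \<longlonglongrightarrow> a'"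
    then obtain b where b: "\<And>n. b n \<in> reduced_Cstar" "\<And>n. is_adj (a n) (b n)"
      by (simp, metis)
    have "Cauchy b"
    proof (rule metric_CauchyI)
      fix e :: real assume "e > 0"
      then obtain M where M: "\<And>m n. m \<ge> M \<Longrightarrow> n \<ge> M \<Longrightarrow> dist (a m) (a n) < e"
        using metric_CauchyD[OF LIMSEQ_imp_Cauchy[OF a(2)]] by blast
      have "dist (b m) (b n) < e" if "m \<ge> M" "n \<ge> M" for m n
        using M[OF that] is_adj_norm[OF is_adj_diff[OF b(2)[of m] b(2)[of n]]] by (simp add: dist_norm)
      then show "\<exists>M. \<forall>m\<ge>M. \<forall>n\<ge>M. dist (b m) (b n) < e" by blast
    qed
    then obtain b' where b': "b \<longlonglongrightarrow> b'"
      by (auto simp: Cauchy_convergent_iff convergent_def)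
    then have "b' \<in> reduced_Cstar"
      using closed_reduced_Cstar b(1) closed_sequential_limits by blast
    moreover have "is_adj a' b'"
      by (rule is_adj_tendsto[OF a(2) b' b(2)])
    ultimately show "a' \<in> {a. \<exists>b\<in>reduced_Cstar. is_adj a b}" by blast
  qed
next
  case (lreg t)
  show ?case using is_adj_lreg lreg_in_reduced_Cstar by blast
next
  case (add a b)
  then show ?case using is_adj_add reduced_Cstar_add by blast
next
  case (scaleC c a)
  then show ?case using is_adj_scaleC reduced_Cstar_scaleC by blast
qed

text \<open>
  The square root \<open>1 - z\<close> of \<open>1 - y\<close> is obtained from the fixed point equation \<open>z = (y + z\<^sup>2) / 2\<close>.
\<close>

lemma reduced_Cstar_sqrt:
  fixes y :: "'g::group_add ell2 \<Rightarrow>\<^sub>L 'g ell2"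
  assumes y: "y \<in> reduced_Cstar" "is_adj y y" "norm y \<le> 3 / 4"
  shows "\<exists>b\<in>reduced_Cstar. is_adj b b \<and> b o\<^sub>L b = id_blinfun - y"
proof -
  \<comment> \<open>Radius \<open>1 / 2\<close> is preserved because
    \<open>(3 / 4 + 1 / 4) / 2 = 1 / 2\<close>, and on this ball the map contracts by
    \<open>(1 / 2 + 1 / 2) / 2 = 1 / 2\<close>.\<close>
  define Z :: "('g ell2 \<Rightarrow>\<^sub>L 'g ell2) set" where "Z = {z. z \<in> reduced_Cstar \<and> is_adj z z \<and> norm z \<le> 1 / 2}"
  define F where "F z = (1 / 2) *\<^sub>R (y + (z o\<^sub>L z))" for z :: "'g ell2 \<Rightarrow>\<^sub>L 'g ell2"
  have "\<exists>!z\<in>Z. F z = z"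
  proof (rule Banach_fix[where c = "1 / 2"])
    have "closed Z"
      unfolding closed_sequential_limits
    proof (intro allI impI, elim conjE)
      fix z l assume z: "\<forall>n. z n \<in> Z" "z \<longlonglongrightarrow> l"
      then have "l \<in> reduced_Cstar"
        using closed_sequentially[OF closed_reduced_Cstar, of z l] by (simp add: Z_def)
      moreover have "is_adj l l"
        using z by (intro is_adj_tendsto[of z l z l]) (auto simp: Z_def)
      moreover have "norm l \<le> 1 / 2"
        using z by (intro Lim_norm_ubound[of sequentially z]) (auto simp: Z_def)
      ultimately show "l \<in> Z" by (simp add: Z_def)
    qed
    then show "complete Z"
      by (simp add: complete_eq_closed)
    have "0 \<in> Z"
      using reduced_Cstar_scaleR[OF y(1), of 0] is_adj_diff[OF y(2) y(2)] by (simp add: Z_def)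
    then show "Z \<noteq> {}" by blast
    have "F z \<in> Z" if "z \<in> Z" for z
    proof -
      have "norm (F z) \<le> (norm y + norm z * norm z) / 2"
        using norm_triangle_ineq[of y "z o\<^sub>L z"] norm_blinfun_compose[of z z] by (simp add: F_def)
      also have "\<dots> \<le> (3 / 4 + 1 / 2 * (1 / 2)) / 2"
        using y that by (intro divide_right_mono add_mono mult_mono) (auto simp: Z_def)
      finally have "norm (F z) \<le> 1 / 2" by simp
      moreover have "is_adj (F z) (F z)"
        using is_adj_scaleC[OF is_adj_add[OF y(2) is_adj_compose[of z z z z]], of "1 / 2"] that
        by (simp add: F_def scaleR_op Z_def)
      ultimately show ?thesis
        using that y by (simp add: Z_def F_def reduced_Cstar_scaleR reduced_Cstar_add reduced_Cstar_compose)
    qed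
    then show "F ` Z \<subseteq> Z" by blast
    show "dist (F z) (F w) \<le> 1 / 2 * dist z w" if "z \<in> Z" "w \<in> Z" for z w
    proof -
      have "F z - F w = (1 / 2) *\<^sub>R ((z o\<^sub>L (z - w)) + ((z - w) o\<^sub>L w))"
        by (simp add: F_def compose_add_diff flip: scaleR_diff_right)
      then have "norm (F z - F w) \<le> (norm z * norm (z - w) + norm (z - w) * norm w) / 2"
        using norm_triangle_ineq[of "z o\<^sub>L (z - w)" "(z - w) o\<^sub>L w"] norm_blinfun_compose[of z "z - w"]
          norm_blinfun_compose[of "z - w" w] by simp
      also have "\<dots> \<le> (1 / 2 * norm (z - w) + norm (z - w) * (1 / 2)) / 2"
        using that by (intro divide_right_mono add_mono mult_mono) (auto simp: Z_def)
      finally show ?thesis by (simp add: dist_norm)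
    qed
  qed simp_all
  then obtain z where z: "z \<in> Z" "F z = z" by blast
  have "2 *\<^sub>R z = y + (z o\<^sub>L z)"
    using arg_cong[OF z(2), of "\<lambda>a. 2 *\<^sub>R a"] by (simp add: F_def)
  then have "(id_blinfun - z) o\<^sub>L (id_blinfun - z) = id_blinfun - y"
    by (simp add: compose_add_diff scaleR_2 algebra_simps)
  moreover have "is_adj (id_blinfun - z) (id_blinfun - z)" "id_blinfun - z \<in> reduced_Cstar"
    using z by (simp_all add: Z_def is_adj_diff is_adj_id reduced_Cstar_diff id_in_reduced_Cstar)
  ultimately show ?thesis by blast
qed

section \<open>Automatic continuity of states and reduction to the generators\<close>

context
  fixes \<phi> :: "('g::group_add ell2 \<Rightarrow>\<^sub>L 'g ell2) \<Rightarrow> complex"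
  assumes state: "is_state reduced_Cstar \<phi>"
begin

lemma state_add: "a \<in> reduced_Cstar \<Longrightarrow> b \<in> reduced_Cstar \<Longrightarrow> \<phi> (a + b) = \<phi> a + \<phi> b"
  and state_scaleC: "a \<in> reduced_Cstar \<Longrightarrow> \<phi> (scaleC_op c a) = c * \<phi> a"
  and state_pos: "a \<in> reduced_Cstar \<Longrightarrow> \<phi> (adj a o\<^sub>L a) \<in> \<real>\<^sub>\<ge>\<^sub>0"
  and state_id: "\<phi> id_blinfun = 1"
  using state unfolding is_state_def by blast+

lemma state_diff:
  assumes "a \<in> reduced_Cstar" "b \<in> reduced_Cstar"
  shows "\<phi> (a - b) = \<phi> a - \<phi> b"
  using state_add[OF reduced_Cstar_diff[OF assms] assms(2)] by simp

text \<open>After scaling \<open>y\<close> to norm \<open>3 / 4\<close>, the radius in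
  \<open>reduced_Cstar_sqrt\<close>, both \<open>1 - y\<close> and \<open>1 + y\<close> are squares
  of self-adjoint elements, so positivity confines the value of the state to \<open>[-1, 1]\<close>.
  Undoing the scaling gives \<open>4 / 3\<close>.\<close>

lemma state_selfadjoint:
  assumes y: "y \<in> reduced_Cstar" "is_adj y y"
  shows "cmod (\<phi> y) \<le> 4 / 3 * norm y"
proof (cases "y = 0")
  case False
  have le: "1 - \<phi> z \<in> \<real>\<^sub>\<ge>\<^sub>0" if z: "z \<in> reduced_Cstar" "is_adj z z" "norm z \<le> 3 / 4" for z
  proof -
    obtain b where "b \<in> reduced_Cstar" "is_adj b b" "b o\<^sub>L b = id_blinfun - z"
      using reduced_Cstar_sqrt[OF z] by blast
    then have "\<phi> (id_blinfun - z) \<in> \<real>\<^sub>\<ge>\<^sub>0"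
      using state_pos[of b] by (simp add: adj_eq)
    then show ?thesis
      using z(1) by (simp add: state_diff id_in_reduced_Cstar state_id)
  qed
  define c where "c = complex_of_real (3 / (4 * norm y))"
  have c: "cmod c * norm y = 3 / 4"
    using False by (simp add: c_def norm_divide norm_mult)
  have "1 - \<phi> (scaleC_op d y) \<in> \<real>\<^sub>\<ge>\<^sub>0" if d: "d = c \<or> d = - c" for d
  proof (rule le)
    show "scaleC_op d y \<in> reduced_Cstar"
      by (rule reduced_Cstar_scaleC[OF y(1)])
    show "is_adj (scaleC_op d y) (scaleC_op d y)"
      using is_adj_scaleC[OF y(2), of d] d by (auto simp: c_def)
    show "norm (scaleC_op d y) \<le> 3 / 4"
    proof (rule norm_blinfun_bound)
      fix x
      have "norm (scaleC_op d y x) = cmod c * norm (y x)"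
        using d by (auto simp: scaleC_op_apply norm_scaleC_ell2)
      also have "\<dots> \<le> cmod c * (norm y * norm x)"
        by (intro mult_left_mono norm_blinfun) simp
      finally show "norm (scaleC_op d y x) \<le> 3 / 4 * norm x"
        using c by (simp add: mult.assoc[symmetric])
    qed simp
  qed
  from this[of c] this[of "- c"] have "1 - c * \<phi> y \<in> \<real>\<^sub>\<ge>\<^sub>0" "1 + c * \<phi> y \<in> \<real>\<^sub>\<ge>\<^sub>0"
    unfolding state_scaleC[OF y(1)] by simp_all
  then have "cmod (c * \<phi> y) \<le> 1"
    by (auto simp: complex_nonneg_Reals_iff cmod_eq_Re)
  then show ?thesis
    using False by (simp add: c_def norm_mult norm_divide field_simps)
qed (use state_diff[OF y(1) y(1)] in simp)

text \<open>Splits \<open>a\<close> into self-adjoint parts, \<open>2 a = h - \<i> k\<close>, each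
  of norm at most \<open>2 * norm a\<close>. This yields the constant \<open>8 / 3\<close>, rounded
  up to \<open>4\<close>.\<close>

lemma state_bound:
  assumes a: "a \<in> reduced_Cstar"
  shows "cmod (\<phi> a) \<le> 4 * norm a"
proof -
  obtain b where b: "b \<in> reduced_Cstar" "is_adj a b"
    using reduced_Cstar_adj[OF a] by blast
  note le = is_adj_norm[OF b(2)]
  define h where "h = a + b"
  define k where "k = scaleC_op \<i> (a - b)"
  have h: "h \<in> reduced_Cstar" "is_adj h h" "norm h \<le> 2 * norm a"
    using a b is_adj_add[OF b(2) is_adj_sym[OF b(2)]] le norm_triangle_ineq[of a b]
    by (simp_all add: h_def reduced_Cstar_add add.commute)
  have "scaleC_op (- \<i>) (b - a) = k"
    by (rule blinfun_eqI, rule ell2_eqI)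
       (simp add: k_def scaleC_op_apply blinfun.diff_left algebra_simps)
  then have k: "k \<in> reduced_Cstar" "is_adj k k"
    using a b is_adj_scaleC[OF is_adj_diff[OF b(2) is_adj_sym[OF b(2)]], of \<i>]
    by (simp_all add: k_def reduced_Cstar_scaleC reduced_Cstar_diff)
  have "norm k \<le> norm (a - b)"
  proof (rule norm_blinfun_bound)
    show "norm (k x) \<le> norm (a - b) * norm x" for x
      using norm_blinfun[of "a - b" x] by (simp add: k_def scaleC_op_apply norm_scaleC_ell2)
  qed simp
  then have "norm k \<le> 2 * norm a"
    using norm_triangle_ineq4[of a b] le by simp
  then have "cmod (\<phi> h) \<le> 8 / 3 * norm a" "cmod (\<phi> k) \<le> 8 / 3 * norm a"
    using state_selfadjoint[OF h(1,2)] state_selfadjoint[OF k] h(3) by linarith+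
  moreover have "2 * \<phi> a = \<phi> h - \<i> * \<phi> k"
    using a b by (simp add: h_def k_def state_add state_scaleC state_diff reduced_Cstar_diff)
  ultimately have "cmod (2 * \<phi> a) \<le> 8 / 3 * norm a + 8 / 3 * norm a"
    using norm_triangle_ineq4[of "\<phi> h" "\<i> * \<phi> k"] by (simp add: norm_mult)
  then show ?thesis
    using norm_ge_zero[of a] by (simp add: norm_mult del: norm_ge_zero)
qed

lemma continuous_on_state: "continuous_on reduced_Cstar \<phi>"
proof (rule lipschitz_on_continuous_on[of 4], rule lipschitz_onI)
  fix a b :: "'g ell2 \<Rightarrow>\<^sub>L 'g ell2" assume "a \<in> reduced_Cstar" "b \<in> reduced_Cstar"
  then show "dist (\<phi> a) (\<phi> b) \<le> 4 * dist a b"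
    using state_bound[of "a - b"] by (simp add: dist_norm state_diff reduced_Cstar_diff)
qed simp

lemma tracial_stateI:
  assumes comm: "\<And>s t. \<phi> (lreg (s + t)) = \<phi> (lreg (t + s))"
  shows "is_tracial_state reduced_Cstar \<phi>"
proof -
  have closed_comm: "closed {a. a \<in> reduced_Cstar \<and> \<phi> (a o\<^sub>L b) = \<phi> (b o\<^sub>L a)}"
    if b: "b \<in> reduced_Cstar" for b
  proof -
    have "continuous_on reduced_Cstar (\<lambda>a. \<phi> (a o\<^sub>L b))"
      by (rule continuous_on_compose2[OF continuous_on_state])
         (auto intro!: continuous_intros reduced_Cstar_compose b)
    moreover have "continuous_on reduced_Cstar (\<lambda>a. \<phi> (b o\<^sub>L a))"
      by (rule continuous_on_compose2[OF continuous_on_state])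
         (auto intro!: continuous_intros reduced_Cstar_compose b)
    ultimately have "continuous_on reduced_Cstar (\<lambda>a. \<phi> (a o\<^sub>L b) - \<phi> (b o\<^sub>L a))"
      by (rule continuous_on_diff)
    from continuous_closed_preimage_constant[OF this closed_reduced_Cstar, of 0]
    show ?thesis by simp
  qed
  \<comment> \<open>An operator that has an adjoint is complex-linear, so scalars pass through every
    element of the algebra.\<close>
  have compose_scaleC: "a o\<^sub>L scaleC_op c b = scaleC_op c (a o\<^sub>L b)" "scaleC_op c a o\<^sub>L b = scaleC_op c (a o\<^sub>L b)"
    if ab: "a \<in> reduced_Cstar" for a b :: "'g ell2 \<Rightarrow>\<^sub>L 'g ell2" and c
  proof -
    obtain a' where "is_adj a a'"
      using reduced_Cstar_adj[OF ab] by blast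
    then have a: "cinner (a x) y = cinner x (a' y)" for x y
      by (rule is_adjD)
    have "a (c *\<^sub>C x) = c *\<^sub>C a x" for x
    proof -
      have "cinner (a (c *\<^sub>C x) - c *\<^sub>C a x) y = 0" for y
        by (simp add: cinner_diff_left cinner_scaleC_left a)
      then show ?thesis
        using cinner_self_ell2[of "a (c *\<^sub>C x) - c *\<^sub>C a x"] by simp
    qed
    then show "a o\<^sub>L scaleC_op c b = scaleC_op c (a o\<^sub>L b)"
      by (intro blinfun_eqI) (simp add: scaleC_op_apply)
    show "scaleC_op c a o\<^sub>L b = scaleC_op c (a o\<^sub>L b)"
      by (intro blinfun_eqI) (simp add: scaleC_op_apply)
  qed
  \<comment> \<open>Membership is carried through the induction because \<open>\<phi>\<close> is
    additive, homogeneous and continuous only on the algebra.\<close>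
  have "a \<in> reduced_Cstar \<and> \<phi> (a o\<^sub>L b) = \<phi> (b o\<^sub>L a)"
    if a: "a \<in> reduced_Cstar" and b: "b \<in> reduced_Cstar" for a b
    using a
  proof (induction rule: reduced_Cstar_induct)
    case closed
    show ?case by (rule closed_comm[OF b])
  next
    case (lreg t)
    have "b \<in> reduced_Cstar \<and> \<phi> (b o\<^sub>L lreg t) = \<phi> (lreg t o\<^sub>L b)"
      using b
    proof (induction rule: reduced_Cstar_induct)
      case closed
      show ?case by (rule closed_comm[OF lreg_in_reduced_Cstar])
    next
      case (lreg s)
      show ?case
        using comm by (simp add: lreg_in_reduced_Cstar flip: lreg_add)
    next
      case (add a b)
      then show ?case
        by (simp add: compose_add_diff state_add reduced_Cstar_add
            reduced_Cstar_compose lreg_in_reduced_Cstar)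
    next
      case (scaleC c a)
      then show ?case
        by (simp add: compose_scaleC state_scaleC reduced_Cstar_scaleC
            reduced_Cstar_compose lreg_in_reduced_Cstar)
    qed
    then show ?case by (simp add: lreg_in_reduced_Cstar)
  next
    case (add a b')
    then show ?case
      using b by (simp add: compose_add_diff state_add reduced_Cstar_add
          reduced_Cstar_compose)
  next
    case (scaleC c a)
    then show ?case
      using b by (simp add: compose_scaleC state_scaleC reduced_Cstar_scaleC reduced_Cstar_compose)
  qed
  with state show ?thesis
    by (simp add: is_tracial_state_def)
qed

end

lemma states_eqI:
  fixes \<phi> \<psi> :: "('g::group_add ell2 \<Rightarrow>\<^sub>L 'g ell2) \<Rightarrow> complex"
  assumes \<phi>: "is_state reduced_Cstar \<phi>" and \<psi>: "is_state reduced_Cstar \<psi>"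
    and eq: "\<And>t. \<phi> (lreg t) = \<psi> (lreg t)"
  shows "\<phi> = \<psi>"
proof (rule extensionalityI[of _ reduced_Cstar])
  fix a :: "'g ell2 \<Rightarrow>\<^sub>L 'g ell2" assume "a \<in> reduced_Cstar"
  then have "a \<in> reduced_Cstar \<and> \<phi> a = \<psi> a"
  proof (induction rule: reduced_Cstar_induct)
    case closed
    show ?case
      using continuous_closed_preimage_constant[OF continuous_on_diff[OF continuous_on_state[OF \<phi>]
        continuous_on_state[OF \<psi>]] closed_reduced_Cstar, of 0] by simp
  next
    case (scaleC c a)
    then show ?case
      by (simp add: state_scaleC[OF \<phi>] state_scaleC[OF \<psi>] reduced_Cstar_scaleC)
  qed (simp_all add: eq lreg_in_reduced_Cstar state_add[OF \<phi>] state_add[OF \<psi>] reduced_Cstar_add)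
  then show "\<phi> a = \<psi> a" ..
qed (use \<phi> \<psi> in \<open>auto simp: is_state_def\<close>)

text \<open>
  The tracial state is the limit of the vector states of almost invariant vectors.
\<close>

lemma tracial_state_of_normal_subgroup:
  fixes N :: "'g::group_add set"
  assumes zero: "0 \<in> N" and add: "\<And>g h. g \<in> N \<Longrightarrow> h \<in> N \<Longrightarrow> g + h \<in> N"
    and uminus: "\<And>g. g \<in> N \<Longrightarrow> - g \<in> N" and conj: "\<And>g s. g \<in> N \<Longrightarrow> s + g - s \<in> N"
    and almost_inv: "\<And>S \<epsilon>. \<lbrakk>finite S; S \<subseteq> N; \<epsilon> > 0\<rbrakk> \<Longrightarrow>
      \<exists>\<xi>. norm \<xi> = 1 \<and> (\<forall>x. x \<notin> N \<longrightarrow> ell2_nth \<xi> x = 0) \<and> (\<forall>s\<in>S. norm (translate s \<xi> - \<xi>) < \<epsilon>)"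
  shows "\<exists>\<tau>. is_tracial_state reduced_Cstar \<tau> \<and> (\<forall>g::'g. \<tau> (lreg g) = of_bool (g \<in> N))"
proof -
  define V where "V = (\<lambda>(S, \<epsilon>). {\<xi>. norm \<xi> = 1 \<and> (\<forall>x. x \<notin> N \<longrightarrow> ell2_nth \<xi> x = 0) \<and>
    (\<forall>s\<in>S. norm (translate s \<xi> - \<xi>) < \<epsilon>)})"
  define I where "I = {(S :: 'g set, \<epsilon> :: real). finite S \<and> S \<subseteq> N \<and> \<epsilon> > 0}"
  \<comment> \<open>The filter of ever more invariant vectors supported in \<open>N\<close>. The
    vector states turn out to converge along \<open>F\<close> itself on the whole algebra, so
    neither an ultrafilter nor weak compactness of the states is used.\<close>
  define F where "F = (INF z\<in>I. principal (V z))"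
  have eventually_F: "eventually P F"
    if "finite S" "S \<subseteq> N" "\<epsilon> > 0" "\<And>\<xi>. \<lbrakk>norm \<xi> = 1; \<And>x. x \<notin> N \<Longrightarrow> ell2_nth \<xi> x = 0;
      \<And>s. s \<in> S \<Longrightarrow> norm (translate s \<xi> - \<xi>) < \<epsilon>\<rbrakk> \<Longrightarrow> P \<xi>" for S \<epsilon> P
    unfolding F_def using that
    by (intro eventually_INF1[of "(S, \<epsilon>)"]) (auto simp: I_def V_def eventually_principal)
  have unit: "eventually (\<lambda>\<xi>. norm \<xi> = 1) F"
    by (rule eventually_F[of "{}" 1]) auto
  have F: "F \<noteq> bot"
  proof
    assume "F = bot"
    moreover have "I \<noteq> {}"
      by (auto simp: I_def intro!: exI[of _ "{}"] exI[of _ 1])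
    moreover have "\<exists>x\<in>I. principal (V x) \<le> inf (principal (V z)) (principal (V w))" if "z \<in> I" "w \<in> I" for z w
      using that
      by (intro bexI[of _ "(fst z \<union> fst w, min (snd z) (snd w))"]) (auto simp: I_def V_def)
    ultimately obtain z where "z \<in> I" "principal (V z) = bot"
      unfolding F_def using INF_filter_bot_base[of I "\<lambda>z. principal (V z)"] by blast
    moreover from this obtain S \<epsilon> where "z = (S, \<epsilon>)" "finite S" "S \<subseteq> N" "\<epsilon> > 0"
      by (auto simp: I_def)
    ultimately show False
      using almost_inv[of S \<epsilon>] by (auto simp: V_def principal_eq_bot_iff)
  qed
  define v where "v a \<xi> = cinner (blinfun_apply a \<xi>) \<xi>" for a and \<xi> :: "'g ell2"
  have v_add: "v (a + b) = (\<lambda>\<xi>. v a \<xi> + v b \<xi>)"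
    and v_scaleC: "v (scaleC_op c a) = (\<lambda>\<xi>. c * v a \<xi>)"
    and v_diff: "v (a - b) = (\<lambda>\<xi>. v a \<xi> - v b \<xi>)" for a b c
    by (simp_all add: fun_eq_iff v_def blinfun.add_left blinfun.diff_left cinner_add_left_ell2 cinner_diff_left
        scaleC_op_apply cinner_scaleC_left)
  have v_le: "cmod (v a \<xi>) \<le> norm a" if "norm \<xi> = 1" for a \<xi>
    using cmod_cinner_le[of "blinfun_apply a \<xi>" \<xi>] norm_blinfun[of a \<xi>] that by (simp add: v_def)
  have v_lreg: "(v (lreg g) \<longlongrightarrow> of_bool (g \<in> N)) F" for g
  proof (cases "g \<in> N")
    case True
    have "eventually (\<lambda>\<xi>. dist (v (lreg g) \<xi>) 1 < \<epsilon>) F" if "\<epsilon> > 0" for \<epsilon>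
    proof (rule eventually_F[of "{g}" \<epsilon>])
      fix \<xi> :: "'g ell2"
      assume \<xi>: "norm \<xi> = 1" "\<And>s. s \<in> {g} \<Longrightarrow> norm (translate s \<xi> - \<xi>) < \<epsilon>"
      have "v (lreg g) \<xi> - 1 = cinner (translate g \<xi> - \<xi>) \<xi>"
        using \<xi> by (simp add: v_def lreg_apply cinner_diff_left cinner_self_ell2)
      then show "dist (v (lreg g) \<xi>) 1 < \<epsilon>"
        using cmod_cinner_le[of "translate g \<xi> - \<xi>" \<xi>] \<xi>(1) \<xi>(2)[of g] by (simp add: dist_norm)
    qed (use True that in auto)
    with True show ?thesis by (simp add: tendsto_iff)
  next
    case False
    have "eventually (\<lambda>\<xi>. v (lreg g) \<xi> = 0) F"
    proof (rule eventually_F[of "{}" 1])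
      fix \<xi> :: "'g ell2"
      assume \<xi>: "\<And>x. x \<notin> N \<Longrightarrow> ell2_nth \<xi> x = 0"
      \<comment> \<open>For \<open>g\<close> outside \<open>N\<close> the coset \<open>g + N\<close>
        misses \<open>N\<close>, so \<open>\<xi>\<close> and its translate have disjoint
        supports.\<close>
      have "ell2_nth \<xi> (- g + s) * cnj (ell2_nth \<xi> s) = 0" for s
      proof (cases "s \<in> N")
        case True
        have "- g + s \<notin> N"
        proof
          assume "- g + s \<in> N"
          from add[OF True uminus[OF this]] have "g \<in> N"
            by (simp add: minus_add)
          with False show False by simp
        qed
        then show ?thesis by (simp add: \<xi>)
      qed (simp add: \<xi>)
      then show "v (lreg g) \<xi> = 0"
        unfolding v_def cinner.rep_eq lreg_apply translate.rep_eq by (rule infsum_0)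
    qed auto
    with False show ?thesis
      by (simp add: tendsto_eventually)
  qed
  \<comment> \<open>Convergence on the generators extends to norm limits because the vector states
    of unit vectors are uniformly contractive.\<close>
  have convergent: "\<exists>l. (v a \<longlongrightarrow> l) F" if "a \<in> reduced_Cstar" for a
    using that
  proof (induction rule: reduced_Cstar_induct)
    case closed
    show ?case
      unfolding closed_sequential_limits
    proof (intro allI impI, elim conjE)
      fix x l assume x: "\<forall>n. x n \<in> {a. \<exists>l. (v a \<longlongrightarrow> l) F}" "x \<longlonglongrightarrow> l"
      then obtain z where z: "\<And>n. (v (x n) \<longlongrightarrow> z n) F"
        unfolding mem_Collect_eq by metis
      have z_le: "dist (z m) (z n) \<le> dist (x m) (x n)" for m n
        unfolding dist_norm
      proof (rule Lim_norm_ubound[OF F])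
        show "(v (x m - x n) \<longlongrightarrow> z m - z n) F"
          unfolding v_diff by (intro tendsto_diff z)
        show "eventually (\<lambda>\<xi>. norm (v (x m - x n) \<xi>) \<le> norm (x m - x n)) F"
          using unit by (rule eventually_mono) (rule v_le)
      qed
      have "Cauchy z"
      proof (rule metric_CauchyI)
        fix e :: real assume "e > 0"
        then obtain M where "\<forall>m\<ge>M. \<forall>n\<ge>M. dist (x m) (x n) < e"
          using metric_CauchyD[OF LIMSEQ_imp_Cauchy[OF x(2)]] by blast
        then show "\<exists>M. \<forall>m\<ge>M. \<forall>n\<ge>M. dist (z m) (z n) < e"
          using z_le le_less_trans by blast
      qed
      then obtain z' where z': "z \<longlonglongrightarrow> z'"
        by (auto simp: Cauchy_convergent_iff convergent_def)
      have "(v l \<longlongrightarrow> z') F"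
      proof (rule tendstoI)
        fix e :: real assume "e > 0"
        then have "e / 3 > 0" by simp
        from eventually_conj[OF tendstoD[OF x(2) this] tendstoD[OF z' this]]
        obtain n where n: "dist (x n) l < e / 3" "dist (z n) z' < e / 3"
          by (auto simp: eventually_sequentially)
        from tendstoD[OF z[of n] \<open>e / 3 > 0\<close>] unit
        show "eventually (\<lambda>\<xi>. dist (v l \<xi>) z' < e) F"
        proof eventually_elim
          case (elim \<xi>)
          have "dist (v (x n) \<xi>) (v l \<xi>) \<le> dist (x n) l"
            using v_le[OF elim(2), of "x n - l"] by (simp add: v_diff dist_norm)
          then show ?case
            using n elim(1) dist_triangle[of "v l \<xi>" z' "v (x n) \<xi>"] dist_triangle[of "v (x n) \<xi>" z' "z n"]
            by (simp add: dist_commute)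
        qed
      qed
      then show "l \<in> {a. \<exists>l. (v a \<longlongrightarrow> l) F}" by blast
    qed
  next
    case (lreg t)
    show ?case using v_lreg by blast
  next
    case (add a b)
    then show ?case unfolding v_add by (blast intro: tendsto_add)
  next
    case (scaleC c a)
    then show ?case unfolding v_scaleC by (blast intro: tendsto_mult_left)
  qed
  define \<tau> where "\<tau> = restrict (\<lambda>a. Lim F (v a)) reduced_Cstar"
  have lim: "(v a \<longlongrightarrow> \<tau> a) F" if "a \<in> reduced_Cstar" for a
    using convergent[OF that] that tendsto_Lim[OF F] by (auto simp: \<tau>_def)
  have \<tau>_eqI: "\<tau> a = l" if "a \<in> reduced_Cstar" "(v a \<longlongrightarrow> l) F" for a l
    using tendsto_unique[OF F lim[OF that(1)] that(2)] .
  have \<tau>_lreg: "\<tau> (lreg g) = of_bool (g \<in> N)" for g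
    by (rule \<tau>_eqI[OF lreg_in_reduced_Cstar v_lreg])
  have state: "is_state reduced_Cstar \<tau>"
    unfolding is_state_def
  proof (intro conjI ballI allI)
    show "\<tau> \<in> extensional reduced_Cstar"
      by (simp add: \<tau>_def)
    show "\<tau> (a + b) = \<tau> a + \<tau> b" if "a \<in> reduced_Cstar" "b \<in> reduced_Cstar" for a b
      using that by (intro \<tau>_eqI reduced_Cstar_add) (auto simp: v_add intro: tendsto_add lim)
    show "\<tau> (scaleC_op c a) = c * \<tau> a" if "a \<in> reduced_Cstar" for a c
      using that by (intro \<tau>_eqI reduced_Cstar_scaleC) (auto simp: v_scaleC intro: tendsto_mult_left lim)
    show "\<tau> id_blinfun = 1"
      using \<tau>_lreg[of 0] zero by (simp add: lreg_zero)
    show "\<tau> (adj a o\<^sub>L a) \<in> \<real>\<^sub>\<ge>\<^sub>0" if a: "a \<in> reduced_Cstar" for a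
    proof -
      obtain b where b: "b \<in> reduced_Cstar" "is_adj a b"
        using reduced_Cstar_adj[OF a] by blast
      have "v (b o\<^sub>L a) \<xi> \<in> \<real>\<^sub>\<ge>\<^sub>0" for \<xi>
        by (simp add: v_def is_adjD[OF is_adj_sym[OF b(2)]] cinner_self_ell2)
      then have "\<tau> (b o\<^sub>L a) \<in> \<real>\<^sub>\<ge>\<^sub>0"
        by (intro Lim_in_closed_set[OF closed_nonneg_Reals_complex _ F lim[OF reduced_Cstar_compose[OF b(1) a]]])
           simp
      then show ?thesis by (simp add: adj_eq[OF b(2)])
    qed
  qed
  \<comment> \<open>The two sums are conjugate to each other, so normality makes the indicator of
    \<open>N\<close> a class function.\<close>
  have "s + t \<in> N \<longleftrightarrow> t + s \<in> N" for s t
    using conj[of "s + t" "- s"] conj[of "t + s" s] by (auto simp: add.assoc[symmetric])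
  then have "is_tracial_state reduced_Cstar \<tau>"
    by (intro tracial_stateI[OF state]) (simp add: \<tau>_lreg)
  with \<tau>_lreg show ?thesis by blast
qed

section \<open>Almost invariant vectors\<close>

lift_definition ket :: "'a \<Rightarrow> 'a ell2" is "\<lambda>a x. of_bool (x = a)"
  by (rule finite_nonzero_values_imp_summable_on) (simp add: of_bool_def)

lemmas [simp] = ket.rep_eq

lemma norm_ket [simp]: "norm (ket a) = 1"
proof -
  have "(norm (ket a))\<^sup>2 = (\<Sum>\<^sub>\<infinity>x\<in>{a}. 1)"
    unfolding norm_ell2_square by (rule infsum_cong_neutral) (auto simp: of_bool_def)
  then show ?thesis
    by (simp add: power2_eq_1_iff) (use norm_ge_zero[of "ket a"] in linarith)
qed

lemma bounded_linear_Re_nth: "bounded_linear (\<lambda>x. Re (ell2_nth x i))"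
  by (rule bounded_linear_intro[of _ 1])
     (auto intro: order_trans[OF abs_Re_le_cmod ell2_nth_le_norm])

text \<open>The parallelogram law for two vectors of equal norm; a large displacement thus forces a
  short sum.\<close>

lemma norm_translate_add_square:
  "(norm (translate s \<xi> + \<xi>))\<^sup>2 = 4 * (norm \<xi>)\<^sup>2 - (norm (translate s \<xi> - \<xi>))\<^sup>2"
proof -
  have "inner (translate s \<xi>) (translate s \<xi>) = inner \<xi> \<xi>"
    by (simp add: norm_translate flip: power2_norm_eq_inner)
  then show ?thesis
    by (simp add: power2_norm_eq_inner inner_add inner_diff_left inner_diff_right inner_commute)
qed

context minimal_invariant
begin

text \<open>
  If \<open>\<Sum>s\<in>S. lreg s\<close> has norm less than \<open>card S\<close> on functions supported in the stabilizer, then its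
  resolvent provides a positive function \<open>U\<close> with \<open>\<Sum>s\<in>S. U (- s + x) \<le> c * U x\<close>, where
  \<open>c < card S\<close>. The increments of \<open>ln U\<close> are bounded and their average is negative by the concavity
  of \<open>ln\<close>, although the symmetry of \<open>S\<close> writes them as a sum of terms \<open>k - lshift s k\<close>.
\<close>

lemma stabilizer_superharmonic:
  fixes U :: "'g \<Rightarrow> real" and c :: real
  assumes S: "finite S" "S \<subseteq> stabilizer" "\<And>s. s \<in> S \<Longrightarrow> - s \<in> S"
    and c: "c > 0" "c < card S"
    and U: "\<And>x. 0 \<le> U x" "U 0 > 0" "\<And>x. (\<Sum>s\<in>S. U (- s + x)) \<le> c * U x"
  shows False
proof -
  \<comment> \<open>Positivity of \<open>U\<close> is only available on the component of
    \<open>0\<close> under left steps from \<open>S\<close>. A representative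
    \<open>\<rho> x\<close> is chosen in each component, and \<open>W\<close> below copies
    \<open>U\<close> to all components by right translation, which commutes with the left
    steps.\<close>
  define R where "R = {(x, s + x) |x s. s \<in> S}"
  define \<rho> where "\<rho> x = (SOME y. (y, x) \<in> R\<^sup>*)" for x
  have \<rho>: "(\<rho> x, x) \<in> R\<^sup>*" for x
    unfolding \<rho>_def by (rule someI[of _ x]) simp
  have \<rho>_shift: "\<rho> (s + x) = \<rho> x" if "s \<in> S" for s x
  proof -
    have "(x, s + x) \<in> R" "(s + x, x) \<in> R"
      using that S(3)[OF that] unfolding R_def by (auto simp flip: add.assoc intro!: exI[of _ "- s"])
    then have "(y, s + x) \<in> R\<^sup>* \<longleftrightarrow> (y, x) \<in> R\<^sup>*" for y
      by (meson rtrancl.rtrancl_into_rtrancl)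
    then show ?thesis by (simp add: \<rho>_def)
  qed
  \<comment> \<open>A Harnack inequality: one term is dominated by the sum. It spreads positivity
    along steps and later bounds the increments of \<open>ln W\<close> by
    \<open>ln c\<close>.\<close>
  have U_le: "U (- s + x) \<le> c * U x" if "s \<in> S" for s x
    using member_le_sum[of s S "\<lambda>s. U (- s + x)"] that S(1) U(1) U(3)[of x] by force
  have U_pos: "U (x - y) > 0" if "(y, x) \<in> R\<^sup>*" for x y
    using that
  proof (induction rule: rtrancl_induct)
    case (step z z')
    then obtain s where s: "s \<in> S" "z' = s + z"
      by (auto simp: R_def)
    have "0 < U (z - y)" by (rule step.IH)
    also have "z - y = - s + (z' - y)"
      by (simp add: s flip: add_diff_eq)
    also have "U \<dots> \<le> c * U (z' - y)"
      by (rule U_le[OF s(1)])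
    finally show ?case
      using c(1) by (simp add: zero_less_mult_iff)
  qed (simp add: U(2))
  define W where "W x = U (x - \<rho> x)" for x
  have W_pos: "W x > 0" for x
    unfolding W_def by (rule U_pos[OF \<rho>])
  have W_shift: "W (- s + x) = U (- s + (x - \<rho> x))" if "s \<in> S" for s x
    using \<rho>_shift[OF S(3)[OF that], of x]
    by (simp add: W_def add.assoc del: add_uminus_conv_diff flip: diff_conv_add_uminus add_diff_eq)
  have W_le: "W (- s + x) \<le> c * W x" if "s \<in> S" for s x
    unfolding W_shift[OF that] using U_le[OF that] by (simp add: W_def)
  have W_ge: "W x \<le> c * W (- s + x)" if "s \<in> S" for s x
    using W_le[OF S(3)[OF that], of "- s + x"] by (simp flip: add.assoc)
  define k where "k s x = ln (W (- s + x)) - ln (W x)" for s x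
  have k_bounded: "bounded (range (k s))" if "s \<in> S" for s
  proof -
    have "\<bar>k s x\<bar> \<le> ln c" for x
    proof -
      have "ln (W (- s + x)) \<le> ln (c * W x)" "ln (W x) \<le> ln (c * W (- s + x))"
        using W_le[OF that, of x] W_ge[OF that, of x] W_pos by (auto simp: ln_le_cancel_iff c)
      moreover have "ln (c * W y) = ln c + ln (W y)" for y
        using c(1) W_pos[of y] by (simp add: ln_mult)
      ultimately show ?thesis
        unfolding k_def by (simp add: abs_le_iff)
    qed
    then show ?thesis
      by (intro boundedI[of _ "ln c"]) auto
  qed
  have k_uminus: "k (- s) x = - k s (s + x)" for s x
    by (simp add: k_def flip: add.assoc)
  have k_sum: "(\<Sum>s\<in>S. k s x) \<le> c - card S" for x
  proof -
    have "(\<Sum>s\<in>S. k s x) \<le> (\<Sum>s\<in>S. W (- s + x) / W x - 1)"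
    proof (rule sum_mono)
      fix s
      have "k s x = ln (W (- s + x) / W x)"
        using W_pos[of x] W_pos[of "- s + x"] by (simp add: k_def ln_div)
      also have "\<dots> \<le> W (- s + x) / W x - 1"
        using W_pos by (intro ln_le_minus_one) simp
      finally show "k s x \<le> W (- s + x) / W x - 1" .
    qed
    also have "\<dots> = (\<Sum>s\<in>S. W (- s + x)) / W x - card S"
      by (simp add: sum_subtractf sum_divide_distrib)
    also have "(\<Sum>s\<in>S. W (- s + x)) \<le> c * W x"
      using U(3)[of "x - \<rho> x"] unfolding W_def[of x] by (simp add: W_shift)
    then have "(\<Sum>s\<in>S. W (- s + x)) / W x - card S \<le> c - card S"
      using W_pos[of x] by (simp add: divide_le_eq)
    finally show ?thesis .
  qed
  define K where "K s = Abs_bfun (k s)" for s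
  have K: "bfun_apply (K s) = k s" if "s \<in> S" for s
    unfolding K_def using k_bounded[OF that] by (simp add: Abs_bfun_inverse)
  \<comment> \<open>Each summand has \<open>p\<close> at most \<open>0\<close> by the definition of
    the stabilizer. Replacing \<open>s\<close> by \<open>- s\<close> shows that \<open>G\<close> is
    \<open>- 2\<close> times the sum of the increments, hence at least
    \<open>2 * (card S - c)\<close> pointwise.\<close>
  define G where "G = (\<Sum>s\<in>S. lshift s (K s) - K s)"
  have "p G \<le> (\<Sum>s\<in>S. p (lshift s (K s) - K s))"
    unfolding G_def by (rule sublinear_sum[OF sublin])
  also have "\<dots> \<le> 0"
    using S(2) by (intro sum_nonpos) (auto simp: stabilizer_def)
  finally have "p G \<le> 0" .
  moreover have "2 * (card S - c) \<le> p G"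
  proof (rule p_ge)
    fix x
    have sum_apply: "bfun_apply (\<Sum>i\<in>I. f i) x = (\<Sum>i\<in>I. bfun_apply (f i) x)"
      for I :: "'g set" and f :: "'g \<Rightarrow> 'g bfun"
      by (induction I rule: infinite_finite_induct) auto
    have "bij_betw uminus S S"
      using S(3) by (intro bij_betw_byWitness[of _ uminus]) auto
    from sum.reindex_bij_betw[OF this, of "\<lambda>s. k s x"]
    have "(\<Sum>s\<in>S. k s (s + x)) = - (\<Sum>s\<in>S. k s x)"
      by (simp add: k_uminus sum_negf)
    moreover have "bfun_apply G x = (\<Sum>s\<in>S. k s (s + x) - k s x)"
      unfolding G_def sum_apply by (rule sum.cong) (simp_all add: K)
    ultimately have "bfun_apply G x = - 2 * (\<Sum>s\<in>S. k s x)"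
      by (simp add: sum_subtractf)
    then show "2 * (card S - c) \<le> bfun_apply G x"
      using k_sum[of x] by simp
  qed
  ultimately show False
    using c(2) by simp
qed

text \<open>If every unit vector supported in the stabilizer were displaced by at least
  \<open>\<epsilon>\<close>, uniform convexity would push the norm of a sum of translations strictly
  below their number, and the resolvent would supply the function excluded by
  \<open>stabilizer_superharmonic\<close>.\<close>

lemma stabilizer_almost_invariant:
  assumes S: "finite S" "S \<subseteq> stabilizer" and \<epsilon>: "\<epsilon> > 0"
  shows "\<exists>\<xi>. norm \<xi> = 1 \<and> (\<forall>x. x \<notin> stabilizer \<longrightarrow> ell2_nth \<xi> x = 0) \<and> (\<forall>s\<in>S. norm (translate s \<xi> - \<xi>) < \<epsilon>)"
proof (rule ccontr)
  assume "\<not> ?thesis"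
  then have no_inv: "\<exists>s\<in>S. \<epsilon> \<le> norm (translate s \<xi> - \<xi>)"
    if "norm \<xi> = 1" "\<And>x. x \<notin> stabilizer \<Longrightarrow> ell2_nth \<xi> x = 0" for \<xi>
    using that by (meson not_le)
  \<comment> \<open>Symmetry is demanded by \<open>stabilizer_superharmonic\<close>; the element
    \<open>0\<close> provides the untranslated \<open>\<xi>\<close> that is paired with a displaced
    translate.\<close>
  define S' where "S' = insert 0 (S \<union> uminus ` S)"
  have S': "finite S'" "S' \<subseteq> stabilizer" "\<And>s. s \<in> S' \<Longrightarrow> - s \<in> S'" "0 \<in> S'" "S \<subseteq> S'"
    using S stabilizer_zero stabilizer_uminus by (auto simp: S'_def)
  define A where "A = (\<Sum>s\<in>S'. lreg s)"
  have A_apply: "A \<xi> = (\<Sum>s\<in>S'. translate s \<xi>)" for \<xi>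
    by (simp add: A_def blinfun.sum_left lreg_apply)
  have nth_sum: "ell2_nth (\<Sum>i\<in>I. f i) x = (\<Sum>i\<in>I. ell2_nth (f i) x)" for I :: "'g set" and f and x :: 'g
    by (induction I rule: infinite_finite_induct) auto
  have A_nth: "ell2_nth (A \<xi>) x = (\<Sum>s\<in>S'. ell2_nth \<xi> (- s + x))" for \<xi> x
    by (simp add: A_apply nth_sum)
  \<comment> \<open>The loss in the triangle inequality for such a pair, by
    \<open>norm_translate_add_square\<close>. Since \<open>sqrt\<close> is strictly monotone on all
    reals, \<open>\<delta>\<close> is positive even if \<open>\<epsilon>\<close> exceeds 2.\<close>
  define \<delta> where "\<delta> = 2 - sqrt (4 - \<epsilon>\<^sup>2)"
  have "sqrt (4 - \<epsilon>\<^sup>2) < sqrt 4"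
    using \<epsilon> by (intro real_sqrt_less_mono) simp
  then have \<delta>: "\<delta> > 0" by (simp add: \<delta>_def)
  define d where "d = card S' - \<delta>"
  have A_unit: "norm (A \<xi>) \<le> d"
    if \<xi>: "norm \<xi> = 1" "\<And>x. x \<notin> stabilizer \<Longrightarrow> ell2_nth \<xi> x = 0" for \<xi>
  proof -
    obtain s where s: "s \<in> S" "\<epsilon> \<le> norm (translate s \<xi> - \<xi>)"
      using no_inv[OF \<xi>] by blast
    have t0: "translate 0 \<xi> = \<xi>"
      by (rule ell2_eqI) simp
    have "s \<noteq> 0"
      using s(2) \<epsilon> t0 by auto
    have "(norm (translate s \<xi> + \<xi>))\<^sup>2 \<le> 4 - \<epsilon>\<^sup>2"
      using s(2) \<epsilon> by (simp add: norm_translate_add_square \<xi>(1) power_mono)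
    then have "norm (translate s \<xi> + \<xi>) \<le> 2 - \<delta>"
      by (simp add: \<delta>_def real_le_rsqrt)
    moreover have "norm (\<Sum>s\<in>S' - {s, 0}. translate s \<xi>) \<le> card (S' - {s, 0})"
      using sum_norm_le[of "S' - {s, 0}" "\<lambda>s. translate s \<xi>" "\<lambda>_. 1"] by (simp add: norm_translate \<xi>(1))
    moreover have "A \<xi> = (translate s \<xi> + \<xi>) + (\<Sum>s\<in>S' - {s, 0}. translate s \<xi>)"
      using sum.subset_diff[of "{s, 0}" S' "\<lambda>s. translate s \<xi>"] S'(1,4,5) s(1) \<open>s \<noteq> 0\<close>
      by (auto simp: A_apply t0 add.commute)
    moreover have "card S' = card (S' - {s, 0}) + 2"
      using card_Diff_subset[of "{s, 0}" S'] card_mono[of S' "{s, 0}"] S'(1,4,5) s(1) \<open>s \<noteq> 0\<close> by auto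
    ultimately show ?thesis
      using norm_triangle_ineq[of "translate s \<xi> + \<xi>" "\<Sum>s\<in>S' - {s, 0}. translate s \<xi>"] by (simp add: d_def)
  qed
  have A_le: "norm (A \<xi>) \<le> d * norm \<xi>" if \<xi>: "\<And>x. x \<notin> stabilizer \<Longrightarrow> ell2_nth \<xi> x = 0" for \<xi>
  proof (cases "\<xi> = 0")
    case False
    have "norm (A ((1 / norm \<xi>) *\<^sub>R \<xi>)) \<le> d"
      using False \<xi> by (intro A_unit) auto
    then show ?thesis
      using False by (simp add: blinfun.scaleR_right field_simps)
  qed (simp add: blinfun.zero_right)
  define w where "w j = (blinfun_apply A ^^ j) (ket 0)" for j
  \<comment> \<open>The estimate \<open>A_le\<close> covers only vectors supported in the
    stabilizer, so all iterates must stay there.\<close>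
  have w_supp: "ell2_nth (w j) x = 0" if "x \<notin> stabilizer" for j x
    using that
  proof (induction j arbitrary: x)
    case 0
    then show ?case using stabilizer_zero by (auto simp: w_def)
  next
    case (Suc j)
    have "- s + x \<notin> stabilizer" if "s \<in> S'" for s
      using stabilizer_add[of s "- s + x"] S'(2) that Suc.prems by (auto simp flip: add.assoc)
    with Suc.IH show ?case by (simp add: w_def A_nth)
  qed
  have d: "d \<ge> 0"
    using A_unit[of "ket 0"] stabilizer_zero norm_ge_zero[of "A (ket 0)"] by (force simp del: norm_ge_zero)
  have w_norm: "norm (w j) \<le> d ^ j" for j
  proof (induction j)
    case (Suc j)
    have "norm (w (Suc j)) \<le> d * norm (w j)"
      using A_le[OF w_supp, of j] by (simp add: w_def)
    also have "\<dots> \<le> d * d ^ j"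
      using d Suc by (rule mult_left_mono[rotated])
    finally show ?case by simp
  qed (simp add: w_def)
  have w_pos: "0 \<le> Re (ell2_nth (w j) x)" for j x
    by (induction j arbitrary: x) (auto simp: w_def A_nth intro: sum_nonneg)
  \<comment> \<open>Midway between \<open>d\<close> and \<open>card S'\<close>: above
    \<open>d\<close> the Neumann series converges, below \<open>card S'\<close> the superharmonic
    contradiction applies.\<close>
  define c where "c = d + \<delta> / 2"
  have c: "c > 0" "d < c" "c < card S'"
    using d \<delta> by (auto simp: c_def d_def)
  define z where "z j = (1 / c ^ j) *\<^sub>R w j" for j
  have z_summable: "summable z"
  proof (rule summable_comparison_test)
    show "summable (\<lambda>j. (d / c) ^ j)"
      using c d by (intro summable_geometric) simp
    have "norm (z j) \<le> (d / c) ^ j" for j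
      using w_norm[of j] c by (simp add: z_def power_divide divide_right_mono)
    then show "\<exists>N. \<forall>n\<ge>N. norm (z n) \<le> (d / c) ^ n" by blast
  qed
  \<comment> \<open>The Neumann series for the inverse of \<open>1 - A / c\<close>, applied to
    \<open>ket 0\<close>. The equation \<open>A u = c *\<^sub>R (u - ket 0)\<close> makes
    \<open>U\<close> superharmonic with a defect only at \<open>0\<close>, which also forces
    \<open>U 0 \<ge> 1\<close>.\<close>
  define u where "u = suminf z"
  have "A u = (\<Sum>j. A (z j))"
    unfolding u_def by (rule bounded_linear.suminf[OF blinfun.bounded_linear_right z_summable])
  also have "A (z j) = c *\<^sub>R z (Suc j)" for j
    using c by (simp add: z_def w_def blinfun.scaleR_right)
  then have "(\<Sum>j. A (z j)) = c *\<^sub>R (\<Sum>j. z (Suc j))"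
    using z_summable by (simp add: suminf_scaleR_right summable_Suc_iff)
  also have "(\<Sum>j. z (Suc j)) = u - ket 0"
    using suminf_split_head[OF z_summable] by (simp add: u_def z_def w_def)
  finally have Au: "A u = c *\<^sub>R (u - ket 0)" .
  define U where "U x = Re (ell2_nth u x)" for x
  have U_nonneg: "0 \<le> U x" for x
  proof -
    have "U x = (\<Sum>j. Re (ell2_nth (z j) x))"
      unfolding U_def u_def by (rule bounded_linear.suminf[OF bounded_linear_Re_nth z_summable])
    also have "0 \<le> \<dots>"
      using w_pos c
      by (intro suminf_nonneg bounded_linear.summable[OF bounded_linear_Re_nth z_summable]) (simp add: z_def)
    finally show ?thesis .
  qed
  have U_sum: "(\<Sum>s\<in>S'. U (- s + x)) = c * (U x - of_bool (x = 0))" for x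
    using arg_cong[OF Au, of "\<lambda>\<xi>. Re (ell2_nth \<xi> x)"] by (simp add: U_def A_nth)
  have "0 \<le> c * (U 0 - 1)"
    using U_sum[of 0] sum_nonneg[of S' "\<lambda>s. U (- s + 0)"] U_nonneg by simp
  then have "U 0 > 0"
    using c(1) by (simp add: zero_le_mult_iff)
  moreover have "(\<Sum>s\<in>S'. U (- s + x)) \<le> c * U x" for x
    unfolding U_sum using c(1) by (intro mult_left_mono) auto
  ultimately show False
    using S'(1-3) c(1,3) U_nonneg by (intro stabilizer_superharmonic[of S' c U])
qed

end

section \<open>Averages of conjugates\<close>

text \<open>Each conjugate moves a translate of \<open>E\<close> off itself, so at every point each
  term is charged to a rare event at its target (\<open>P\<close>) or at its source
  (\<open>Q\<close>). Weighted Cauchy-Schwarz makes each part contribute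
  \<open>2 * \<epsilon>\<close> to the bound on the squared norm.\<close>

lemma displaced_average_norm:
  fixes E :: "'g::group_add set" and u :: "nat \<Rightarrow> real"
  assumes E: "\<And>x. x \<in> E \<Longrightarrow> t + x \<notin> E"
    and u: "\<And>i. i \<in> I \<Longrightarrow> 0 \<le> u i" "(\<Sum>i\<in>I. u i) = 1"
    and \<epsilon>: "\<And>x. (\<Sum>i\<in>I. u i * of_bool (s i + x \<notin> E)) \<le> \<epsilon>"
  shows "norm (\<Sum>i\<in>I. u i *\<^sub>R lreg (- s i + t + s i)) \<le> 2 * sqrt \<epsilon>" (is "norm ?a \<le> _")
proof (rule norm_blinfun_bound)
  have I: "finite I"
    using u(2) by (metis sum.infinite zero_neq_one)
  have "0 \<le> (\<Sum>i\<in>I. u i * of_bool (s i + 0 \<notin> E))"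
    using u(1) by (intro sum_nonneg) simp
  then have \<epsilon>_nonneg: "\<epsilon> \<ge> 0"
    using \<epsilon>[of 0] by linarith
  then show "0 \<le> 2 * sqrt \<epsilon>" by simp
  fix \<xi> :: "'g ell2"
  define t' where "t' i = - s i + t + s i" for i
  define g where "g i y = cmod (ell2_nth \<xi> (- t' i + y))" for i y
  define P where "P i y = (of_bool (s i + y \<notin> E) :: real)" for i y
  define Q where "Q i y = P i (- t' i + y)" for i y
  \<comment> \<open>If the source \<open>s i + (- t' i + y)\<close> lies in \<open>E\<close>, its
    translate by \<open>t\<close> is the target \<open>s i + y\<close>, which then lies
    outside.\<close>
  have PQ: "1 \<le> P i y + Q i y" for i y
    using E[of "s i + (- t' i + y)"]
    by (auto simp: P_def Q_def t'_def minus_add add.assoc simp del: add_uminus_conv_diff)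
  have P_sq: "(P i y)\<^sup>2 = P i y" and Q_sq: "(Q i y)\<^sup>2 = Q i y" for i y
    by (simp_all add: P_def Q_def)
  have cauchy: "(\<Sum>i\<in>I. u i * (f i * h i))\<^sup>2 \<le> (\<Sum>i\<in>I. u i * (f i)\<^sup>2) * (\<Sum>i\<in>I. u i * (h i)\<^sup>2)" for f h :: "nat \<Rightarrow> real"
  proof -
    have "(\<Sum>i\<in>I. u i * (f i * h i)) = (\<Sum>i\<in>I. (sqrt (u i) * f i) * (sqrt (u i) * h i))"
      using u(1) by (intro sum.cong) (auto simp: algebra_simps)
    also have "\<dots>\<^sup>2 \<le> (\<Sum>i\<in>I. (sqrt (u i) * f i)\<^sup>2) * (\<Sum>i\<in>I. (sqrt (u i) * h i)\<^sup>2)"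
      by (rule Cauchy_Schwarz_ineq_sum)
    also have "\<dots> = (\<Sum>i\<in>I. u i * (f i)\<^sup>2) * (\<Sum>i\<in>I. u i * (h i)\<^sup>2)"
      using u(1) by (simp add: power_mult_distrib)
    finally show ?thesis .
  qed
  have a_nth: "ell2_nth (?a \<xi>) y = (\<Sum>i\<in>I. complex_of_real (u i) * ell2_nth \<xi> (- t' i + y))" for y
  proof -
    have "ell2_nth (\<Sum>i\<in>J. f i) y = (\<Sum>i\<in>J. ell2_nth (f i) y)" for J :: "nat set" and f
      by (induction J rule: infinite_finite_induct) auto
    then show ?thesis
      by (simp add: blinfun.sum_left blinfun.scaleR_left lreg_apply t'_def)
  qed
  have pointwise: "(cmod (ell2_nth (?a \<xi>) y))\<^sup>2 \<le>
      2 * \<epsilon> * (\<Sum>i\<in>I. u i * (g i y)\<^sup>2) + 2 * (\<Sum>i\<in>I. u i * (Q i y * (g i y)\<^sup>2))" for y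
  proof -
    have g: "0 \<le> g i y" for i by (simp add: g_def)
    have "cmod (ell2_nth (?a \<xi>) y) \<le> (\<Sum>i\<in>I. u i * g i y)"
      unfolding a_nth using u(1) by (intro sum_norm_le) (simp add: norm_mult g_def)
    also have "\<dots> \<le> (\<Sum>i\<in>I. u i * (P i y * g i y) + u i * (Q i y * g i y))"
    proof (rule sum_mono)
      fix i assume "i \<in> I"
      then have "u i * g i y * 1 \<le> u i * g i y * (P i y + Q i y)"
        using u(1) g PQ by (intro mult_left_mono) auto
      then show "u i * g i y \<le> u i * (P i y * g i y) + u i * (Q i y * g i y)"
        by (simp add: algebra_simps)
    qed
    also have "\<dots> = (\<Sum>i\<in>I. u i * (P i y * g i y)) + (\<Sum>i\<in>I. u i * (Q i y * g i y))" (is "_ = ?p + ?q")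
      by (rule sum.distrib)
    finally have "(cmod (ell2_nth (?a \<xi>) y))\<^sup>2 \<le> (?p + ?q)\<^sup>2"
      by (rule power_mono) simp
    also have "\<dots> \<le> 2 * ?p\<^sup>2 + 2 * ?q\<^sup>2"
      using sum_squares_bound[of ?p ?q] by (simp add: power2_sum)
    also have "?p\<^sup>2 \<le> (\<Sum>i\<in>I. u i * (P i y)\<^sup>2) * (\<Sum>i\<in>I. u i * (g i y)\<^sup>2)"
      by (rule cauchy)
    also have "(\<Sum>i\<in>I. u i * (P i y)\<^sup>2) * (\<Sum>i\<in>I. u i * (g i y)\<^sup>2) \<le> \<epsilon> * (\<Sum>i\<in>I. u i * (g i y)\<^sup>2)"
      using \<epsilon>[of y] u(1) unfolding P_sq
      by (intro mult_right_mono sum_nonneg) (auto simp: P_def)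
    \<comment> \<open>At fixed \<open>y\<close> the weight of \<open>Q\<close> need not be small, so
      here the other factor is the total weight 1. Smallness returns after summing over
      \<open>y\<close>, when \<open>- t' i + y\<close> becomes the summation variable.\<close>
    also have "?q\<^sup>2 \<le> (\<Sum>i\<in>I. u i * 1\<^sup>2) * (\<Sum>i\<in>I. u i * (Q i y * g i y)\<^sup>2)"
      using cauchy[of "\<lambda>_. 1" "\<lambda>i. Q i y * g i y"] by simp
    also have "\<dots> = (\<Sum>i\<in>I. u i * (Q i y * (g i y)\<^sup>2))"
      by (simp add: u(2) power_mult_distrib Q_sq)
    finally show ?thesis by simp
  qed
  \<comment> \<open>The substitution depends on \<open>i\<close>, so the finite set \<open>Y\<close>
    is enlarged to the union \<open>X\<close> of its images, and only finite sums are
    exchanged.\<close>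
  have reindex: "(\<Sum>y\<in>Y. \<Sum>i\<in>I. u i * f i (- t' i + y)) \<le> C * (norm \<xi>)\<^sup>2"
    if Y: "finite Y" and C: "C \<ge> 0" and f: "\<And>i x. 0 \<le> f i x" "\<And>x. (\<Sum>i\<in>I. u i * f i x) \<le> C * (cmod (ell2_nth \<xi> x))\<^sup>2"
    for Y C and f :: "nat \<Rightarrow> 'g \<Rightarrow> real"
  proof -
    define X where "X = (\<Union>i\<in>I. (\<lambda>y. - t' i + y) ` Y)"
    have X: "finite X" using I Y by (simp add: X_def)
    have "(\<Sum>y\<in>Y. \<Sum>i\<in>I. u i * f i (- t' i + y)) = (\<Sum>i\<in>I. u i * (\<Sum>y\<in>Y. f i (- t' i + y)))"
      by (subst sum.swap) (simp add: sum_distrib_left)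
    also have "\<dots> = (\<Sum>i\<in>I. u i * (\<Sum>x\<in>(\<lambda>y. - t' i + y) ` Y. f i x))"
      by (subst sum.reindex) (auto simp: inj_on_def)
    also have "\<dots> \<le> (\<Sum>i\<in>I. u i * (\<Sum>x\<in>X. f i x))"
      using u(1) f(1) X by (intro sum_mono mult_left_mono sum_mono2) (auto simp: X_def)
    also have "\<dots> = (\<Sum>x\<in>X. \<Sum>i\<in>I. u i * f i x)"
      by (subst sum.swap) (simp add: sum_distrib_left)
    also have "\<dots> \<le> (\<Sum>x\<in>X. C * (cmod (ell2_nth \<xi> x))\<^sup>2)"
      by (rule sum_mono) (rule f(2))
    also have "\<dots> \<le> C * (norm \<xi>)\<^sup>2"
      unfolding sum_distrib_left[symmetric] by (intro mult_left_mono ell2_sum_le X C)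
    finally show ?thesis .
  qed
  have "(norm (?a \<xi>))\<^sup>2 \<le> 4 * \<epsilon> * (norm \<xi>)\<^sup>2"
    unfolding norm_ell2_square[of "?a \<xi>"]
  proof (rule infsum_le_finite_sums[OF ell2_summable])
    fix Y :: "'g set" assume Y: "finite Y"
    have "(\<Sum>y\<in>Y. (cmod (ell2_nth (?a \<xi>) y))\<^sup>2) \<le>
        (\<Sum>y\<in>Y. 2 * \<epsilon> * (\<Sum>i\<in>I. u i * (g i y)\<^sup>2) + 2 * (\<Sum>i\<in>I. u i * (Q i y * (g i y)\<^sup>2)))"
      by (rule sum_mono) (rule pointwise)
    also have "\<dots> = 2 * \<epsilon> * (\<Sum>y\<in>Y. \<Sum>i\<in>I. u i * (g i y)\<^sup>2) + 2 * (\<Sum>y\<in>Y. \<Sum>i\<in>I. u i * (Q i y * (g i y)\<^sup>2))"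
      by (simp only: sum.distrib sum_distrib_left)
    also have "\<dots> \<le> 2 * \<epsilon> * (1 * (norm \<xi>)\<^sup>2) + 2 * (\<epsilon> * (norm \<xi>)\<^sup>2)"
    proof (intro add_mono mult_left_mono)
      show "(\<Sum>y\<in>Y. \<Sum>i\<in>I. u i * (g i y)\<^sup>2) \<le> 1 * (norm \<xi>)\<^sup>2"
        unfolding g_def using Y by (rule reindex) (simp_all add: u(2) flip: sum_distrib_right)
      show "(\<Sum>y\<in>Y. \<Sum>i\<in>I. u i * (Q i y * (g i y)\<^sup>2)) \<le> \<epsilon> * (norm \<xi>)\<^sup>2"
        unfolding g_def Q_def
      proof (rule reindex[OF Y \<epsilon>_nonneg, of "\<lambda>i x. P i x * (cmod (ell2_nth \<xi> x))\<^sup>2"])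
        fix x
        have "(\<Sum>i\<in>I. u i * (P i x * (cmod (ell2_nth \<xi> x))\<^sup>2)) = (\<Sum>i\<in>I. u i * P i x) * (cmod (ell2_nth \<xi> x))\<^sup>2"
          by (simp add: sum_distrib_right mult.assoc)
        also have "\<dots> \<le> \<epsilon> * (cmod (ell2_nth \<xi> x))\<^sup>2"
          using \<epsilon>[of x] by (intro mult_right_mono) (simp_all add: P_def)
        finally show "(\<Sum>i\<in>I. u i * (P i x * (cmod (ell2_nth \<xi> x))\<^sup>2)) \<le> \<epsilon> * (cmod (ell2_nth \<xi> x))\<^sup>2" .
      qed (simp add: P_def)
    qed (use \<epsilon>_nonneg in simp_all)
    finally show "(\<Sum>y\<in>Y. (cmod (ell2_nth (?a \<xi>) y))\<^sup>2) \<le> 4 * \<epsilon> * (norm \<xi>)\<^sup>2"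
      by (simp add: algebra_simps)
  qed
  also have "4 * \<epsilon> * (norm \<xi>)\<^sup>2 = (2 * sqrt \<epsilon> * norm \<xi>)\<^sup>2"
    using \<epsilon>_nonneg by (simp add: power_mult_distrib)
  finally show "norm (?a \<xi>) \<le> 2 * sqrt \<epsilon> * norm \<xi>"
    using \<epsilon>_nonneg by (simp add: power2_le_iff_abs_le)
qed

lemma (in minimal_invariant) zero_in_closure_conjugates:
  assumes "p (h + lshift t h) < 2 * p h"
  shows "0 \<in> closure (convex hull {lreg (s + t - s) | s. True})"
  unfolding closure_approachable
proof (intro allI impI)
  fix e :: real assume e: "e > 0"
  \<comment> \<open>Chosen so that \<open>2 * sqrt \<epsilon>\<close> is
    \<open>e / 2\<close>.\<close>
  define \<epsilon> where "\<epsilon> = (e / 4)\<^sup>2"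
  have "\<epsilon> > 0" using e by (simp add: \<epsilon>_def)
  from displaced_set[OF assms this] obtain E n and u :: "nat \<Rightarrow> real" and s where
    E: "\<And>x. x \<in> E \<Longrightarrow> t + x \<notin> E" and u: "\<And>i. i \<in> {1..n} \<Longrightarrow> 0 \<le> u i" "(\<Sum>i=1..n. u i) = 1"
    and \<epsilon>: "\<And>x. (\<Sum>i=1..n. u i * of_bool (s i + x \<notin> E)) \<le> \<epsilon>"
    by blast
  define a where "a = (\<Sum>i=1..n. u i *\<^sub>R lreg (- s i + t + s i))"
  have "a \<in> convex hull {lreg (s + t - s) | s. True}"
    unfolding a_def
  proof (rule convex_sum)
    show "lreg (- s i + t + s i) \<in> convex hull {lreg (s + t - s) |s. True}" for i
      by (rule hull_inc) (auto intro!: exI[of _ "- s i"])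
  qed (use u in auto)
  moreover have "norm a \<le> 2 * sqrt \<epsilon>"
    unfolding a_def by (rule displaced_average_norm[OF E u \<epsilon>])
  then have "dist a 0 < e"
    using e by (simp add: \<epsilon>_def)
  ultimately show "\<exists>a\<in>convex hull {lreg (s + t - s) | s. True}. dist a 0 < e"
    by blast
qed

section \<open>Traces on conjugacy classes and the equivalence\<close>

lemma tracial_state_lreg_eq_zero:
  fixes t :: "'g::group_add"
  assumes \<tau>: "is_tracial_state reduced_Cstar \<tau>"
    and t: "0 \<in> closure (convex hull {lreg (s + t - s) | s. True})"
  shows "\<tau> (lreg t) = 0"
proof -
  have state: "is_state reduced_Cstar \<tau>"
    and comm: "\<And>a b. a \<in> reduced_Cstar \<Longrightarrow> b \<in> reduced_Cstar \<Longrightarrow> \<tau> (a o\<^sub>L b) = \<tau> (b o\<^sub>L a)"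
    using \<tau> unfolding is_tracial_state_def by blast+
  \<comment> \<open>A closed convex set containing the conjugates, hence their closed hull;
    restricting to the algebra gives access to the linearity and continuity of the state.\<close>
  define L where "L = {a \<in> reduced_Cstar. \<tau> a = \<tau> (lreg t)}"
  have "lreg (s + t - s) \<in> L" for s
    using comm[OF lreg_in_reduced_Cstar[of s] lreg_in_reduced_Cstar[of "t - s"]]
    by (simp add: L_def lreg_in_reduced_Cstar add_diff_eq flip: lreg_add)
  moreover have "convex L"
  proof (rule convexI)
    fix a b and \<alpha> \<beta> :: real
    assume ab: "a \<in> L" "b \<in> L" and \<alpha>: "\<alpha> + \<beta> = 1"
    then have "\<tau> (\<alpha> *\<^sub>R a + \<beta> *\<^sub>R b) = complex_of_real \<alpha> * \<tau> (lreg t) + complex_of_real \<beta> * \<tau> (lreg t)"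
      by (simp add: L_def state_add[OF state] reduced_Cstar_scaleC state_scaleC[OF state] scaleR_op)
    also have "\<dots> = \<tau> (lreg t)"
      using arg_cong[OF \<alpha>, of complex_of_real] by (simp flip: distrib_right)
    finally show "\<alpha> *\<^sub>R a + \<beta> *\<^sub>R b \<in> L"
      using ab by (simp add: L_def reduced_Cstar_add reduced_Cstar_scaleR)
  qed
  ultimately have "convex hull {lreg (s + t - s) | s. True} \<subseteq> L"
    by (intro hull_minimal) auto
  moreover have "closed L"
    unfolding L_def
    by (rule continuous_closed_preimage_constant[OF continuous_on_state[OF state] closed_reduced_Cstar])
  ultimately have "0 \<in> L"
    using t closure_minimal by blast
  then show ?thesis
    using state_diff[OF state lreg_in_reduced_Cstar lreg_in_reduced_Cstar, of t t] by (simp add: L_def)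
qed

text \<open>The trivial subgroup as \<open>N\<close>: the point mass \<open>ket 0\<close> is exactly
  invariant.\<close>

lemma canonical_trace_exists:
  "\<exists>\<tau>. is_tracial_state reduced_Cstar \<tau> \<and> (\<forall>g::'g::group_add. \<tau> (lreg g) = of_bool (g = 0))"
proof -
  have "translate 0 \<xi> = \<xi>" for \<xi> :: "'g ell2"
    by (rule ell2_eqI) simp
  then have "\<exists>\<xi>. norm \<xi> = 1 \<and> (\<forall>x. x \<notin> {0} \<longrightarrow> ell2_nth \<xi> x = 0) \<and> (\<forall>s\<in>S. norm (translate s \<xi> - \<xi>) < \<epsilon>)"
    if "S \<subseteq> {0 :: 'g}" "\<epsilon> > 0" for S \<epsilon>
    using that by (intro exI[of _ "ket 0"]) auto
  then show ?thesis
    using tracial_state_of_normal_subgroup[of "{0 :: 'g}"] by simp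
qed

theorem corollary4p4:
  shows "(\<exists>!\<tau>. is_tracial_state (reduced_Cstar :: ('g::group_add ell2 \<Rightarrow>\<^sub>L 'g ell2) set) \<tau>) \<longleftrightarrow>
    (\<forall>t::'g. t \<noteq> 0 \<longrightarrow> 0 \<in> closure (convex hull {lreg (s + t - s) | s. True}))"
proof (intro iffI allI impI)
  fix t :: 'g
  assume unique: "\<exists>!\<tau>. is_tracial_state (reduced_Cstar :: ('g ell2 \<Rightarrow>\<^sub>L 'g ell2) set) \<tau>" and t: "t \<noteq> 0"
  obtain p :: "'g bfun \<Rightarrow> real" where "minimal_invariant p"
    using minimal_invariant_exists by blast
  then interpret minimal_invariant p .
  have "t \<notin> stabilizer"
  proof
    assume "t \<in> stabilizer"
    obtain \<tau> where \<tau>: "is_tracial_state reduced_Cstar \<tau>" "\<And>g::'g. \<tau> (lreg g) = of_bool (g \<in> stabilizer)"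
      using tracial_state_of_normal_subgroup[OF stabilizer_zero stabilizer_add stabilizer_uminus
          stabilizer_conj stabilizer_almost_invariant] by blast
    obtain \<tau>' where \<tau>': "is_tracial_state reduced_Cstar \<tau>'" "\<And>g::'g. \<tau>' (lreg g) = of_bool (g = 0)"
      using canonical_trace_exists by blast
    have "\<tau> = \<tau>'"
      using unique \<tau>(1) \<tau>'(1) by blast
    then show False
      using \<tau>(2)[of t] \<tau>'(2)[of t] t \<open>t \<in> stabilizer\<close> by simp
  qed
  then obtain f where "\<not> p (lshift t f - f) \<le> 0"
    by (auto simp: stabilizer_def)
  then obtain h where "p (h + lshift t h) < 2 * p h"
    using lshift_fixes[of t f] by (meson not_le)
  then show "0 \<in> closure (convex hull {lreg (s + t - s) | s. True})"
    by (rule zero_in_closure_conjugates)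
next
  assume *: "\<forall>t::'g. t \<noteq> 0 \<longrightarrow> 0 \<in> closure (convex hull {lreg (s + t - s) | s. True})"
  obtain \<tau> where \<tau>: "is_tracial_state reduced_Cstar \<tau>" "\<And>g::'g. \<tau> (lreg g) = of_bool (g = 0)"
    using canonical_trace_exists by blast
  show "\<exists>!\<tau>. is_tracial_state (reduced_Cstar :: ('g ell2 \<Rightarrow>\<^sub>L 'g ell2) set) \<tau>"
  proof (rule ex1I[of _ \<tau>])
    fix \<sigma> assume \<sigma>: "is_tracial_state (reduced_Cstar :: ('g ell2 \<Rightarrow>\<^sub>L 'g ell2) set) \<sigma>"
    have states: "is_state reduced_Cstar \<sigma>" "is_state reduced_Cstar \<tau>"
      using \<sigma> \<tau>(1) by (auto simp: is_tracial_state_def)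
    show "\<sigma> = \<tau>"
    proof (rule states_eqI[OF states])
      fix t :: 'g
      show "\<sigma> (lreg t) = \<tau> (lreg t)"
      proof (cases "t = 0")
        case True
        then show ?thesis
          using state_id[OF states(1)] state_id[OF states(2)] by (simp add: lreg_zero)
      next
        case False
        then show ?thesis
          using tracial_state_lreg_eq_zero[OF \<sigma>] * \<tau>(2)[of t] by simp
      qed
    qed
  qed (rule \<tau>(1))
qed

end
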